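(* Let $\sigma$ be a complex polynomial of degree $\le2$, $\sigma\neq0$, let $\kappa_0$ be a complex polynomial of degree $\le1$, and let $\rho_0$ be a (nonzero) solution of $(\sigma(z)\partial_z-\kappa_0(z))\rho_0(z)=0$. For $n\in\mathbb{C}$ set $\kappa_n(z):=n\sigma'(z)+\kappa_0(z)$ and $\omega_n:=n^2\frac{\sigma''}{2}+(n+\frac12)\kappa_0'$. Let $n\in\mathbb{C}$. Suppose that the curve $[0,1]\ni\tau\overset{\gamma}{\mapsto}s(\tau)$ satisfies $$\sigma(s)(s-z)^{-n-2}\rho_0^{-1}(s)\Big|_{s(0)}^{s(1)}=0$$ and that $$f_n(z):=\int_\gamma(s-z)^{-n-1}\rho_0^{-1}(s)\,ds$$ is well-defined. Then $f_n$ is annihilated by $$\mathcal{H}(\sigma,\kappa_n)+\omega_n=\sigma(z)\partial_z^2+\big(\kappa_0(z)+(n+1)\sigma'(z)\big)\partial_z+\kappa_0'(n+1)+\frac{\sigma''}{2}n(n+1).$$ Besides, if $f_{n+1}$ (given by the same formula with $n$ replaced by $n+1$) is also well-defined, then $$\partial_zf_n(z)=(n+1)f_{n+1}(z),$$ $$\big(\sigma(z)\partial_z+\kappa_{n+1}(z)\big)f_{n+1}(z)=-\Big(\kappa_0'+\frac{\sigma''}{2}n\Big)f_n(z).$$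
   Context: $\mathcal{H}(\sigma,\kappa):=\sigma(z)\partial_z^2+(\sigma'(z)+\kappa(z))\partial_z+\frac12\kappa'$. The functions of $s$ involved are in general multivalued, i.e. defined on a certain Riemann surface; they are analytically continued along the curve $\gamma$ contained in this Riemann surface. The notation $f(s)\big|_{s_0}^{s_1}=f(s_1)-f(s_0)$ is used, where $s_0,s_1$ are the endpoints of the curve $\gamma$. *)

theory Defs
  imports
    "HOL-Complex_Analysis.Complex_Analysis"
    "HOL-Computational_Algebra.Polynomial"
begin

definition hyp_op ::
  "complex poly \<Rightarrow> complex poly \<Rightarrow> (complex \<Rightarrow> complex) \<Rightarrow> complex \<Rightarrow> complex" where
  "hyp_op \<sigma> \<kappa> f z =
     poly \<sigma> z * deriv (deriv f) z
     + (poly (pderiv \<sigma>) z + poly \<kappa> z) * deriv f z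
     + 1/2 * poly (pderiv \<kappa>) z * f z"

definition kappa :: "complex poly \<Rightarrow> complex poly \<Rightarrow> complex \<Rightarrow> complex poly" where
  "kappa \<sigma> \<kappa>0 n = smult n (pderiv \<sigma>) + \<kappa>0"

text \<open>For \<open>degree \<sigma> \<le> 2\<close> and \<open>degree \<kappa>0 \<le> 1\<close> this is a constant polynomial.\<close>

definition omega :: "complex poly \<Rightarrow> complex poly \<Rightarrow> complex \<Rightarrow> complex poly" where
  "omega \<sigma> \<kappa>0 n = smult (n\<^sup>2 / 2) (pderiv (pderiv \<sigma>)) + smult (n + 1/2) (pderiv \<kappa>0)"

text \<open>
  Only the restriction of a curve to the open interval \<open>(0,1)\<close> is used.  This way its ends may be
  singular points of the integrand, or infinity; values at the ends are understood as limits.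
\<close>

definition C1_curve :: "(real \<Rightarrow> complex) \<Rightarrow> bool" where
  "C1_curve \<gamma> \<longleftrightarrow>
     (\<forall>a b. 0 < a \<longrightarrow> a < b \<longrightarrow> b < 1 \<longrightarrow> \<gamma> piecewise_C1_differentiable_on {a..b})"

text \<open>\<open>g\<bar>\<^bsub>s(0)\<^esub>\<^bsup>s(1)\<^esup> = d\<close>, where \<open>g\<close> is given as a function of the curve parameter.\<close>

definition has_boundary_difference :: "(real \<Rightarrow> complex) \<Rightarrow> complex \<Rightarrow> bool" where
  "has_boundary_difference g d \<longleftrightarrow>
     (\<exists>g0 g1. (g \<longlongrightarrow> g0) (at_right 0) \<and> (g \<longlongrightarrow> g1) (at_left 1) \<and> g1 - g0 = d)"

text \<open>
  A multivalued function on a curve is a family of germs: \<open>F t\<close> represents the germ at \<open>\<gamma> t\<close>, and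
  neighbouring germs are direct analytic continuations of each other.  The value of the function
  at the point of the Riemann surface with parameter \<open>t\<close> is \<open>F t (\<gamma> t)\<close>.
\<close>

definition analytic_continuation_along ::
  "(real \<Rightarrow> complex) \<Rightarrow> (real \<Rightarrow> complex \<Rightarrow> complex) \<Rightarrow> bool" where
  "analytic_continuation_along \<gamma> F \<longleftrightarrow>
     (\<forall>t\<in>{0<..<1}. F t analytic_on {\<gamma> t} \<and>
        (\<forall>\<^sub>F u in at t. \<forall>\<^sub>F s in nhds (\<gamma> u). F u s = F t s))"

text \<open>
  \<open>\<rho>\<close> is a nonzero multivalued solution of \<open>(\<sigma>(s) \<partial>\<^sub>s - \<kappa>0(s)) \<rho>(s) = 0\<close> whose reciprocal is continued
  analytically along \<open>\<gamma>\<close>.  The equation is imposed on punctured neighbourhoods, so \<open>\<gamma>\<close> may pass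
  through a pole of \<open>\<rho>\<close>, i.e. a zero of \<open>1/\<rho>\<close> (with \<open>\<rho> = 0\<close> there, as \<open>inverse 0 = 0\<close>).
\<close>

definition nonzero_solution_along ::
  "complex poly \<Rightarrow> complex poly \<Rightarrow> (real \<Rightarrow> complex) \<Rightarrow> (real \<Rightarrow> complex \<Rightarrow> complex) \<Rightarrow> bool" where
  "nonzero_solution_along \<sigma> \<kappa>0 \<gamma> \<rho> \<longleftrightarrow>
     (\<forall>t\<in>{0<..<1}. \<forall>\<^sub>F s in at (\<gamma> t).
        \<rho> t s \<noteq> 0 \<and> \<rho> t field_differentiable (at s) \<and>
        poly \<sigma> s * deriv (\<rho> t) s - poly \<kappa>0 s * \<rho> t s = 0) \<and>
     analytic_continuation_along \<gamma> (\<lambda>t s. inverse (\<rho> t s))"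

text \<open>
  \<open>L t z\<close> is a branch of \<open>log (s - z)\<close> at \<open>s = \<gamma> t\<close>, chosen continuously along the curve and in the
  parameter \<open>z\<close>; in particular \<open>\<Omega>\<close> does not meet the curve.  The powers of \<open>s - z\<close> are defined by it,
  which makes the branches for different exponents compatible.
\<close>

definition log_branch_along ::
  "(real \<Rightarrow> complex) \<Rightarrow> complex set \<Rightarrow> (real \<Rightarrow> complex \<Rightarrow> complex) \<Rightarrow> bool" where
  "log_branch_along \<gamma> \<Omega> L \<longleftrightarrow>
     continuous_on ({0<..<1} \<times> \<Omega>) (\<lambda>(t, z). L t z) \<and>
     (\<forall>t\<in>{0<..<1}. \<forall>z\<in>\<Omega>. exp (L t z) = \<gamma> t - z)"

definition branch_power ::
  "(real \<Rightarrow> complex \<Rightarrow> complex) \<Rightarrow> complex \<Rightarrow> real \<Rightarrow> complex \<Rightarrow> complex" where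
  "branch_power L a t z = exp (a * L t z)"

definition integrand ::
  "(real \<Rightarrow> complex) \<Rightarrow> (real \<Rightarrow> complex \<Rightarrow> complex) \<Rightarrow> (real \<Rightarrow> complex \<Rightarrow> complex) \<Rightarrow>
     complex \<Rightarrow> complex \<Rightarrow> real \<Rightarrow> complex" where
  "integrand \<gamma> \<rho> L n z t =
     branch_power L (- n - 1) t z * inverse (\<rho> t (\<gamma> t)) * vector_derivative \<gamma> (at t)"

text \<open>
  Existence of the Henstock--Kurzweil integral: this includes absolutely convergent integrals as well
  as conditionally convergent improper ones.
\<close>

definition f_well_defined ::
  "(real \<Rightarrow> complex) \<Rightarrow> (real \<Rightarrow> complex \<Rightarrow> complex) \<Rightarrow> (real \<Rightarrow> complex \<Rightarrow> complex) \<Rightarrow>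
     complex \<Rightarrow> complex set \<Rightarrow> bool" where
  "f_well_defined \<gamma> \<rho> L n \<Omega> \<longleftrightarrow> (\<forall>z\<in>\<Omega>. integrand \<gamma> \<rho> L n z integrable_on {0..1})"

definition f_integral ::
  "(real \<Rightarrow> complex) \<Rightarrow> (real \<Rightarrow> complex \<Rightarrow> complex) \<Rightarrow> (real \<Rightarrow> complex \<Rightarrow> complex) \<Rightarrow>
     complex \<Rightarrow> complex \<Rightarrow> complex" where
  "f_integral \<gamma> \<rho> L n z = integral {0..1} (integrand \<gamma> \<rho> L n z)"

end

theory Submission
  imports Defs "HOL-Real_Asymp.Real_Asymp"
begin

text \<open>
  Write \<open>I\<^sub>m\<close> for the integral with exponent \<open>-m-1\<close> over \<open>[a,b]\<close>, \<open>0 < a < b < 1\<close>. Then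
  \<open>I\<^sub>m' = (m+1) I\<^sub>m\<^sub>+\<^sub>1\<close>, and integrating the derivative of \<open>h(s) = \<sigma>(s) (s-z)\<^bsup>-n-2\<^esup> / \<rho>(s)\<close> gives
  \<open>\<sigma> I\<^sub>n\<^sub>+\<^sub>1' + \<kappa>\<^sub>n\<^sub>+\<^sub>1 I\<^sub>n\<^sub>+\<^sub>1 + (\<kappa>0' + n \<sigma>''/2) I\<^sub>n = h(a) - h(b)\<close>, hence a second-order equation for \<open>I\<^sub>n\<close>.

  The improper integral is only known to converge for each \<open>z\<close> separately, which does not suffice to
  pass to the limit. The boundary terms are locally bounded in \<open>z\<close>, uniformly as \<open>(a,b)\<close> tends to
  \<open>(0,1)\<close>, since \<open>(s-z)/(s-z0)\<close> is bounded above and below for \<open>z\<close> near \<open>z0\<close>. By the second-order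
  equation, the values of \<open>I\<^sub>n\<close> at two nearby points then control it on a small disc (by the maximum
  principle also around a zero of \<open>\<sigma>\<close>). So the \<open>I\<^sub>n\<close> are locally bounded and Montel's theorem applies.
\<close>

subsection \<open>Locally bounded sequences and second-order equations\<close>

text \<open>The bound \<open>B\<close> is chosen before \<open>k\<close>: it is uniform along the
  sequence, which is the boundedness hypothesis of Montel's theorem in local form.\<close>

definition locally_bounded_on :: "complex set \<Rightarrow> (nat \<Rightarrow> complex \<Rightarrow> complex) \<Rightarrow> bool" where
  "locally_bounded_on S F \<longleftrightarrow>
     (\<forall>z\<in>S. \<exists>e>0. \<exists>B. \<forall>k. \<forall>w\<in>ball z e. norm (F k w) \<le> B)"

lemma locally_bounded_on_compact:
  assumes "locally_bounded_on S F" "compact K" "K \<subseteq> S"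
  shows "\<exists>B. \<forall>k. \<forall>z\<in>K. norm (F k z) \<le> B"
proof -
  have "\<forall>z\<in>K. \<exists>e>0. \<exists>B. \<forall>k. \<forall>w\<in>ball z e. norm (F k w) \<le> B"
    using assms(1,3) unfolding locally_bounded_on_def by blast
  then obtain e B where e: "\<And>z. z \<in> K \<Longrightarrow> e z > 0"
    and B: "\<And>z k w. z \<in> K \<Longrightarrow> w \<in> ball z (e z) \<Longrightarrow> norm (F k w) \<le> B z"
    by metis
  have "K \<subseteq> (\<Union>z\<in>K. ball z (e z))"
    using e by force
  then obtain D where D: "D \<subseteq> K" "finite D" "K \<subseteq> (\<Union>z\<in>D. ball z (e z))"
    using compactE_image[OF assms(2), of K "\<lambda>z. ball z (e z)"] by auto
  \<comment> \<open>The sum of absolute values replaces a maximum of the finitely many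
    \<open>B z\<close>, so that an empty \<open>D\<close> needs no separate case.\<close>
  have "norm (F k w) \<le> (\<Sum>z\<in>D. \<bar>B z\<bar>)" if w: "w \<in> K" for k w
  proof -
    obtain z where z: "z \<in> D" "w \<in> ball z (e z)"
      using D(3) w by blast
    have "norm (F k w) \<le> \<bar>B z\<bar>"
      using B[of z w k] z D(1) by (meson abs_ge_self order_trans subsetD)
    also have "\<dots> \<le> (\<Sum>z\<in>D. \<bar>B z\<bar>)"
      using z(1) D(2) by (intro member_le_sum) auto
    finally show ?thesis .
  qed
  then show ?thesis by blast
qed

lemma locally_bounded_on_cmult:
  assumes "locally_bounded_on S F"
  shows "locally_bounded_on S (\<lambda>k z. c * F k z)"
  unfolding locally_bounded_on_def
proof
  fix z assume "z \<in> S"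
  then obtain e B where e: "e > 0" and B: "\<And>k w. w \<in> ball z e \<Longrightarrow> norm (F k w) \<le> B"
    using assms unfolding locally_bounded_on_def by metis
  have "norm (c * F k w) \<le> norm c * B" if "w \<in> ball z e" for k w
    using B[OF that] by (simp add: norm_mult mult_left_mono)
  then show "\<exists>e>0. \<exists>B. \<forall>k. \<forall>w\<in>ball z e. norm (c * F k w) \<le> B"
    using e by blast
qed

lemma locally_bounded_on_diff:
  assumes "locally_bounded_on S F" "locally_bounded_on S G"
  shows "locally_bounded_on S (\<lambda>k z. F k z - G k z)"
  unfolding locally_bounded_on_def
proof
  fix z assume "z \<in> S"
  then obtain e B e' B' where e: "e > 0" "e' > 0"
    and B: "\<And>k w. w \<in> ball z e \<Longrightarrow> norm (F k w) \<le> B"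
      "\<And>k w. w \<in> ball z e' \<Longrightarrow> norm (G k w) \<le> B'"
    using assms unfolding locally_bounded_on_def by metis
  have "norm (F k w - G k w) \<le> B + B'" if "w \<in> ball z (min e e')" for k w
    using B(1)[of w k] B(2)[of w k] that norm_triangle_ineq4[of "F k w" "G k w"] by auto
  then show "\<exists>e>0. \<exists>B. \<forall>k. \<forall>w\<in>ball z e. norm (F k w - G k w) \<le> B"
    using e by (intro exI[of _ "min e e'"] conjI exI[of _ "B + B'"]) auto
qed

text \<open>Montel's theorem gives a locally uniformly convergent subsequence; pointwise convergence
  identifies its limit as \<open>v\<close>, and Weierstrass' theorem carries all derivatives along.
  A subsequence suffices, since it is only used to identify limits.\<close>

lemma locally_bounded_convergent:
  assumes S: "open S" and holo: "\<And>k. F k holomorphic_on S" and bdd: "locally_bounded_on S F"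
    and lim: "\<And>z. z \<in> S \<Longrightarrow> (\<lambda>k. F k z) \<longlonglongrightarrow> v z"
  obtains r :: "nat \<Rightarrow> nat" where "v holomorphic_on S" "strict_mono r"
    "\<And>j z. z \<in> S \<Longrightarrow> (\<lambda>k. (deriv ^^ j) (F (r k)) z) \<longlonglongrightarrow> (deriv ^^ j) v z"
proof -
  have bd: "\<exists>B. \<forall>h\<in>range F. \<forall>z\<in>K. norm (h z) \<le> B" if K: "compact K" "K \<subseteq> S" for K
    using locally_bounded_on_compact[OF bdd K] by auto
  have "\<exists>g r. g holomorphic_on S \<and> strict_mono (r :: nat \<Rightarrow> nat) \<and>
      (\<forall>x\<in>S. (\<lambda>k. F (r k) x) \<longlonglongrightarrow> g x) \<and>
      (\<forall>K. compact K \<longrightarrow> K \<subseteq> S \<longrightarrow> uniform_limit K (F \<circ> r) g sequentially)"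
    by (rule Montel[of S "range F" F, OF S]) (use holo bd in blast)+
  then obtain g r where g: "g holomorphic_on S" and r: "strict_mono (r :: nat \<Rightarrow> nat)"
    and gl: "\<And>x. x \<in> S \<Longrightarrow> (\<lambda>k. F (r k) x) \<longlonglongrightarrow> g x"
    and ul: "\<And>K. compact K \<Longrightarrow> K \<subseteq> S \<Longrightarrow> uniform_limit K (F \<circ> r) g sequentially"
    by blast
  have eq: "g x = v x" if "x \<in> S" for x
    using LIMSEQ_unique[OF gl[OF that]] LIMSEQ_subseq_LIMSEQ[OF lim[OF that] r] by (simp add: o_def)
  have "(\<lambda>k. (deriv ^^ j) (F (r k)) z) \<longlonglongrightarrow> (deriv ^^ j) v z" if z: "z \<in> S" for j z
  proof -
    obtain d where d: "d > 0" "cball z d \<subseteq> S"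
      using S z open_contains_cball by blast
    have "uniform_limit (ball z d) (F \<circ> r) g sequentially"
      using uniform_limit_on_subset[OF ul[OF compact_cball d(2)] ball_subset_cball] .
    moreover have "\<forall>\<^sub>F k in sequentially. (F \<circ> r) k holomorphic_on ball z d"
      using holomorphic_on_subset[OF holo order_trans[OF ball_subset_cball d(2)]] by simp
    ultimately have "(\<lambda>k. (deriv ^^ j) ((F \<circ> r) k) z) \<longlonglongrightarrow> (deriv ^^ j) g z"
      by (rule higher_deriv_complex_uniform_limit) (use d in auto)
    moreover have "(deriv ^^ j) g z = (deriv ^^ j) v z"
      using eq S z by (intro higher_deriv_cong_ev refl) (auto simp: eventually_nhds)
    ultimately show ?thesis by (simp add: o_def)
  qed
  moreover have "v holomorphic_on S"
    using g holomorphic_transform[of g S v] eq by auto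
  ultimately show thesis using r that by blast
qed

text \<open>The Taylor formula at \<open>c\<close>, evaluated at the second point, controls \<open>f' c\<close>; on a small disc
  the contribution of \<open>f''\<close> is absorbed.\<close>

lemma two_point_bound:
  fixes f f' f'' :: "complex \<Rightarrow> complex"
  assumes r: "0 < r" "r \<le> 1" "8 * A * r \<le> 1" and A: "0 \<le> A"
    and df: "\<And>z. z \<in> cball c r \<Longrightarrow> (f has_field_derivative f' z) (at z)"
    and d2: "\<And>z. z \<in> cball c r \<Longrightarrow> (f' has_field_derivative f'' z) (at z)"
    and bd: "\<And>z. z \<in> cball c r \<Longrightarrow> norm (f'' z) \<le> A * (norm (f' z) + norm (f z) + 1)"
    and C: "norm (f c) \<le> C" "norm (f (c + of_real r)) \<le> C"
    and z: "z \<in> cball c r"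
  shows "norm (f z) \<le> C + 4 * C / r + (C + 1) / 2"
proof -
  have c: "c \<in> cball c r" "c + of_real r \<in> cball c r"
    using r by (auto simp: dist_norm)
  have C0: "0 \<le> C" using C(1) norm_ge_zero order_trans by blast
  have "continuous_on (cball c r) f'"
    using d2 by (meson DERIV_isCont continuous_at_imp_continuous_on)
  then have "continuous_on (cball c r) (\<lambda>z. norm (f' z))"
    by (intro continuous_intros)
  then obtain x where x: "x \<in> cball c r" "\<And>y. y \<in> cball c r \<Longrightarrow> norm (f' y) \<le> norm (f' x)"
    using continuous_attains_sup[OF compact_cball, of c r "\<lambda>z. norm (f' z)"] c by auto
  define M where "M = norm (f' x)"
  have M: "norm (f' y) \<le> M" if "y \<in> cball c r" for y
    using x(2) that by (simp add: M_def)
  have M0: "0 \<le> M" by (simp add: M_def)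
  have dist: "norm (y - c) \<le> r" if "y \<in> cball c r" for y
    using that by (simp add: dist_norm norm_minus_commute)
  have fb: "norm (f y) \<le> C + M * r" if "y \<in> cball c r" for y
  proof -
    have "norm (f y - f c) \<le> M * norm (y - c)"
      by (rule field_differentiable_bound[OF convex_cball, where f' = f'])
         (use df M that c in \<open>auto intro: has_field_derivative_at_within\<close>)
    also have "\<dots> \<le> M * r"
      using dist[OF that] M0 by (intro mult_left_mono)
    finally show ?thesis
      using C(1) norm_triangle_sub[of "f y" "f c"] by linarith
  qed
  define T where "T = A * (2 * M + C + 1)"
  have T: "norm (f'' y) \<le> T" if "y \<in> cball c r" for y
  proof -
    have "M * r \<le> M" using r M0 by (simp add: mult_left_le)
    then have "norm (f' y) + norm (f y) + 1 \<le> 2 * M + C + 1"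
      using M[OF that] fb[OF that] by linarith
    then show ?thesis
      using bd[OF that] A unfolding T_def by (meson mult_left_mono order_trans)
  qed
  have T0: "0 \<le> T" using A M0 C0 by (simp add: T_def)
  have f'b: "norm (f' y - f' c) \<le> T * r" if "y \<in> cball c r" for y
  proof -
    have "norm (f' y - f' c) \<le> T * norm (y - c)"
      by (rule field_differentiable_bound[OF convex_cball, where f' = f''])
         (use d2 T that c in \<open>auto intro: has_field_derivative_at_within\<close>)
    also have "\<dots> \<le> T * r"
      using dist[OF that] T0 by (intro mult_left_mono)
    finally show ?thesis .
  qed
  \<comment> \<open>The function \<open>f y - f' c * y\<close> has derivative
    \<open>f' y - f' c\<close>, of norm at most \<open>T * r\<close>, so the mean value inequality
    yields the Taylor remainder.\<close>
  have "norm ((f (c + of_real r) - f' c * (c + of_real r)) - (f c - f' c * c))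
      \<le> (T * r) * norm (c + of_real r - c)"
    by (rule field_differentiable_bound[OF convex_cball[of c r], where f' = "\<lambda>y. f' y - f' c"
          and f = "\<lambda>y. f y - f' c * y"])
       (use f'b c in \<open>auto intro!: derivative_eq_intros has_field_derivative_at_within[OF df]\<close>)
  then have "norm (f (c + of_real r) - f c - f' c * of_real r) \<le> T * r * r"
    using r by (simp add: algebra_simps)
  then have "norm (f' c * of_real r) \<le> 2 * C + T * r * r"
    using C norm_triangle_ineq4[of "f (c + of_real r)" "f c"]
      norm_triangle_sub[of "f' c * of_real r" "f (c + of_real r) - f c"]
    by (simp add: norm_minus_commute)
  then have "norm (f' c) * r \<le> (2 * C / r + T * r) * r"
    using r by (simp add: norm_mult algebra_simps)
  then have "norm (f' c) \<le> 2 * C / r + T * r"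
    using r(1) mult_right_le_imp_le by blast
  then have "M \<le> 2 * C / r + 2 * (T * r)"
    using f'b[OF x(1)] norm_triangle_sub[of "f' x" "f' c"] unfolding M_def by linarith
  \<comment> \<open>By \<open>8 * A * r \<le> 1\<close> this term is at most
    \<open>M / 2 + (C + 1) / 4\<close>; the half of \<open>M\<close> is absorbed into the left-hand
    side, whence the factor 4 in the bound.\<close>
  moreover have "2 * (T * r) = (8 * A * r) * ((2 * M + C + 1) / 4)"
    by (simp add: T_def field_simps)
  moreover have "\<dots> \<le> 1 * ((2 * M + C + 1) / 4)"
    using r M0 C0 by (intro mult_right_mono) auto
  ultimately have "M \<le> 4 * C / r + (C + 1) / 2" by (simp add: field_simps)
  moreover have "M * r \<le> M" using r M0 by (simp add: mult_left_le)
  ultimately show ?thesis using fb[OF z] by linarith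
qed

lemma convergent_seq_bounded:
  fixes X :: "nat \<Rightarrow> complex"
  assumes "X \<longlonglongrightarrow> l"
  obtains C where "C \<ge> 0" "\<And>k. norm (X k) \<le> C"
  using assms by (metis BseqE convergentI convergent_imp_Bseq less_imp_le)

text \<open>Where \<open>s\<close> does not vanish one can divide by it. The bounds for the
  coefficients and for \<open>E k\<close> do not depend on \<open>k\<close>, so one radius
  \<open>r\<close> serves all \<open>k\<close> in \<open>two_point_bound\<close>; pointwise
  convergence at \<open>z0\<close> and \<open>z0 + r\<close> bounds the two values required
  there.\<close>

lemma second_order_regular_bound:
  fixes s p q :: "complex \<Rightarrow> complex"
  assumes S: "open S" and holo: "\<And>k. F k holomorphic_on S"
    and cont: "continuous_on S s" "continuous_on S p" "continuous_on S q"
    and ode: "\<And>k z. z \<in> S \<Longrightarrow> s z * deriv (deriv (F k)) z + p z * deriv (F k) z + q z * F k z = E k z"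
    and E: "locally_bounded_on S E"
    and lim: "\<And>z. z \<in> S \<Longrightarrow> (\<lambda>k. F k z) \<longlonglongrightarrow> v z"
    and z0: "z0 \<in> S" "s z0 \<noteq> 0"
  obtains e B where "e > 0" "\<And>k w. w \<in> ball z0 e \<Longrightarrow> norm (F k w) \<le> B"
proof -
  have "open {z \<in> S. s z \<noteq> 0}"
    using continuous_open_preimage[OF cont(1) S, of "- {0}"]
    by (simp add: vimage_def Int_def open_Compl)
  then obtain R where R: "R > 0" "cball z0 R \<subseteq> {z \<in> S. s z \<noteq> 0}"
    using z0 open_contains_cball by blast
  have sub: "cball z0 R \<subseteq> S" and nz: "\<And>z. z \<in> cball z0 R \<Longrightarrow> s z \<noteq> 0"
    using R by auto
  have bnd: "\<exists>B. \<forall>z\<in>cball z0 R. norm (g z) \<le> B"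
    if "continuous_on (cball z0 R) g" for g :: "complex \<Rightarrow> complex"
    using compact_imp_bounded[OF compact_continuous_image[OF that compact_cball]]
    by (auto simp: bounded_iff)
  have "\<exists>B. \<forall>z\<in>cball z0 R. norm (p z / s z) \<le> B" "\<exists>B. \<forall>z\<in>cball z0 R. norm (q z / s z) \<le> B"
    "\<exists>B. \<forall>z\<in>cball z0 R. norm (1 / s z) \<le> B"
    using nz by (intro bnd continuous_intros continuous_on_subset[OF _ sub] cont; simp)+
  then obtain P Q N where P: "\<And>z. z \<in> cball z0 R \<Longrightarrow> norm (p z / s z) \<le> P"
    and Q: "\<And>z. z \<in> cball z0 R \<Longrightarrow> norm (q z / s z) \<le> Q"
    and N: "\<And>z. z \<in> cball z0 R \<Longrightarrow> norm (1 / s z) \<le> N"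
    by metis
  obtain D where D: "\<And>k z. z \<in> cball z0 R \<Longrightarrow> norm (E k z) \<le> D"
    using locally_bounded_on_compact[OF E compact_cball sub] by blast
  have zz: "z0 \<in> cball z0 R" using R by simp
  have pos: "0 \<le> P" "0 \<le> Q" "0 \<le> N" "0 \<le> D"
    using P[OF zz] Q[OF zz] N[OF zz] D[OF zz] norm_ge_zero order_trans by blast+
  define A where "A = P + Q + N * D"
  have A0: "0 \<le> A" using pos by (simp add: A_def)
  \<comment> \<open>The radius is dictated by \<open>8 * A * r \<le> 1\<close>; \<open>A + 1\<close>
    in place of \<open>A\<close> keeps the denominator nonzero.\<close>
  define X where "X = 1 / (8 * (A + 1))"
  have X: "0 < X" using A0 by (simp add: X_def)
  define r where "r = min R (min 1 X)"
  have r: "0 < r" "r \<le> R" "r \<le> 1" "r \<le> 1 / (8 * (A + 1))"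
    using R X unfolding X_def[symmetric] by (auto simp: r_def)
  have "8 * A * r \<le> 8 * (A + 1) * (1 / (8 * (A + 1)))"
    using r A0 by (intro mult_mono) auto
  then have Ar: "8 * A * r \<le> 1" using A0 by (simp add: field_simps)
  have cb: "cball z0 r \<subseteq> cball z0 R" using r by (simp add: subset_cball)
  have z1: "z0 + of_real r \<in> S"
    using sub r by (auto simp: subset_iff dist_norm)
  obtain C1 where C1: "C1 \<ge> 0" "\<And>k. norm (F k z0) \<le> C1"
    using convergent_seq_bounded[OF lim[OF z0(1)]] by blast
  obtain C2 where C2: "C2 \<ge> 0" "\<And>k. norm (F k (z0 + of_real r)) \<le> C2"
    using convergent_seq_bounded[OF lim[OF z1]] by blast
  define C where "C = C1 + C2"
  have C: "norm (F k z0) \<le> C" "norm (F k (z0 + of_real r)) \<le> C" for k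
    using C1 C2 by (auto simp: C_def add_increasing add_increasing2)
  have "norm (F k z) \<le> C + 4 * C / r + (C + 1) / 2" if z: "z \<in> cball z0 r" for k z
  proof (rule two_point_bound[OF r(1,3) Ar A0, where f = "F k" and c = z0 and z = z and f' = "deriv (F k)" and f'' = "deriv (deriv (F k))"])
    fix y assume y: "y \<in> cball z0 r"
    then have yS: "y \<in> S" and yR: "y \<in> cball z0 R" using sub cb by auto
    show "(F k has_field_derivative deriv (F k) y) (at y)"
      using holomorphic_derivI[OF holo S yS] .
    show "(deriv (F k) has_field_derivative deriv (deriv (F k)) y) (at y)"
      using holomorphic_derivI[OF holomorphic_deriv[OF holo S] S yS] .
    have "deriv (deriv (F k)) y
        = 1 / s y * E k y - (p y / s y * deriv (F k) y + q y / s y * F k y)"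
      using ode[OF yS, of k] nz[OF yR] by (simp add: field_simps)
    then have "norm (deriv (deriv (F k)) y) \<le> norm (1 / s y) * norm (E k y)
        + (norm (p y / s y) * norm (deriv (F k) y) + norm (q y / s y) * norm (F k y))"
      by (simp only: norm_mult[symmetric]) (meson norm_triangle_ineq norm_triangle_ineq4 add_left_mono order_trans)
    also have "\<dots> \<le> N * D + (P * norm (deriv (F k) y) + Q * norm (F k y))"
      using N[OF yR] D[OF yR] P[OF yR] Q[OF yR] pos
      by (intro add_mono mult_mono) auto
    also have "\<dots> \<le> A + (A * norm (deriv (F k) y) + A * norm (F k y))"
      using pos unfolding A_def by (intro add_mono mult_right_mono) auto
    finally show "norm (deriv (deriv (F k)) y) \<le> A * (norm (deriv (F k) y) + norm (F k y) + 1)"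
      by (simp add: algebra_simps)
  qed (use C z in auto)
  then show thesis
    using r(1) that[of r] by force
qed

text \<open>The zeros of \<open>s\<close> are isolated. A small circle around one of them lies in
  the regular region, where the bounds hold, and the maximum principle carries the bound
  inside.\<close>

lemma second_order_locally_bounded:
  fixes s :: "complex poly" and p q :: "complex \<Rightarrow> complex"
  assumes S: "open S" and holo: "\<And>k. F k holomorphic_on S"
    and s: "s \<noteq> 0" and cont: "continuous_on S p" "continuous_on S q"
    and ode: "\<And>k z. z \<in> S \<Longrightarrow>
      poly s z * deriv (deriv (F k)) z + p z * deriv (F k) z + q z * F k z = E k z"
    and E: "locally_bounded_on S E"
    and lim: "\<And>z. z \<in> S \<Longrightarrow> (\<lambda>k. F k z) \<longlonglongrightarrow> v z"
  shows "locally_bounded_on S F"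
proof -
  have cs: "continuous_on S (poly s)" by (intro continuous_intros)
  let ?U = "{z \<in> S. poly s z \<noteq> 0}"
  have U: "locally_bounded_on ?U F"
    unfolding locally_bounded_on_def
  proof
    fix z assume "z \<in> ?U"
    then obtain e B where "e > 0" "\<And>k w. w \<in> ball z e \<Longrightarrow> norm (F k w) \<le> B"
      using second_order_regular_bound[OF S holo cs cont ode E lim, of z] by blast
    then show "\<exists>e>0. \<exists>B. \<forall>k. \<forall>w\<in>ball z e. norm (F k w) \<le> B" by blast
  qed
  show ?thesis
    unfolding locally_bounded_on_def
  proof
    fix z assume z: "z \<in> S"
    \<comment> \<open>Only the roots different from \<open>z\<close> are removed, so
      \<open>z\<close> may itself be a root while the circle around it avoids all roots.\<close>
    have fin: "finite ({x. poly s x = 0} - {z})" using poly_roots_finite[OF s] by simp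
    then have "open (S - ({x. poly s x = 0} - {z}))"
      using S finite_imp_closed open_Diff by blast
    then obtain e where e: "e > 0" "cball z e \<subseteq> S - ({x. poly s x = 0} - {z})"
      using z open_contains_cball by blast
    have "sphere z e \<subseteq> ?U" using e by (force simp: subset_iff)
    then obtain B where B: "\<And>k w. w \<in> sphere z e \<Longrightarrow> norm (F k w) \<le> B"
      using locally_bounded_on_compact[OF U compact_sphere] by blast
    have "norm (F k w) \<le> B" if w: "w \<in> ball z e" for k w
    proof (rule maximum_modulus_frontier[of "F k" "cball z e"])
      show "F k holomorphic_on interior (cball z e)"
        using e by (intro holomorphic_on_subset[OF holo]) (use ball_subset_cball in \<open>auto simp: subset_iff\<close>)
      show "continuous_on (closure (cball z e)) (F k)"
        using e by (intro holomorphic_on_imp_continuous_on holomorphic_on_subset[OF holo]) auto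
    qed (use B w in auto)
    then show "\<exists>e>0. \<exists>B. \<forall>k. \<forall>w\<in>ball z e. norm (F k w) \<le> B" using e by blast
  qed
qed

section \<open>Polynomials of low degree and the identity behind the recurrence\<close>

lemma degree_le_1E:
  assumes "degree (p :: 'a :: zero poly) \<le> 1"
  obtains a b where "p = [:a, b:]"
proof -
  obtain a q where p: "p = pCons a q" by (cases p)
  then have "degree q = 0" using assms by (cases "q = 0") auto
  then show thesis using p that by (metis degree_0_id degree_eq_zeroE)
qed

lemma degree_le_2E:
  assumes "degree (p :: 'a :: zero poly) \<le> 2"
  obtains a b c where "p = [:a, b, c:]"
proof -
  obtain a q where p: "p = pCons a q" by (cases p)
  then have "degree q \<le> 1" using assms by (cases "q = 0") auto
  then show thesis using p that by (metis degree_le_1E)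
qed

text \<open>The left side is what remains of the derivative of \<open>h\<close> once
  \<open>(s-z)^(-n-3) / \<rho>\<close> is factored out and
  \<open>\<sigma> (1/\<rho>)' = - \<kappa>0 / \<rho>\<close> is used. The right side expands it in
  powers of \<open>s - z\<close>, matching the exponents of the integrals with index
  \<open>n + 2\<close>, \<open>n + 1\<close> and \<open>n\<close>. The degree bounds end the Taylor
  expansions at \<open>z\<close> in time.\<close>

lemma hypergeometric_poly_identity:
  fixes \<sigma> \<kappa>0 :: "complex poly"
  assumes "degree \<sigma> \<le> 2" "degree \<kappa>0 \<le> 1"
  shows "poly (pderiv \<sigma>) s * (s - z) - (n + 2) * poly \<sigma> s - poly \<kappa>0 s * (s - z) =
    - ((n + 2) * poly \<sigma> z + ((n + 1) * poly (pderiv \<sigma>) z + poly \<kappa>0 z) * (s - z)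
       + (poly (pderiv \<kappa>0) z + poly (pderiv (pderiv \<sigma>)) z / 2 * n) * (s - z)\<^sup>2)"
proof -
  obtain a b c where "\<sigma> = [:a, b, c:]" using degree_le_2E[OF assms(1)] .
  moreover obtain p q where "\<kappa>0 = [:p, q:]" using degree_le_1E[OF assms(2)] .
  ultimately show ?thesis
    by (simp add: pderiv_pCons field_simps power2_eq_square)
qed

subsection \<open>The weight and the powers along the curve\<close>

text \<open>The boundary condition and the convergence of the integral depend on the exponent; they
  enter only in the passage to the limit.\<close>

locale hypergeometric_curve =
  fixes \<sigma> \<kappa>0 :: "complex poly" and \<gamma> :: "real \<Rightarrow> complex"
    and \<rho> L :: "real \<Rightarrow> complex \<Rightarrow> complex" and \<Omega> :: "complex set"
  assumes deg_\<sigma>: "degree \<sigma> \<le> 2" and nz_\<sigma>: "\<sigma> \<noteq> 0" and deg_\<kappa>0: "degree \<kappa>0 \<le> 1"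
    and curve: "C1_curve \<gamma>"
    and weight: "nonzero_solution_along \<sigma> \<kappa>0 \<gamma> \<rho>"
    and open_\<Omega>: "open \<Omega>"
    and branch: "log_branch_along \<gamma> \<Omega> L"
begin

lemma isCont_curve:
  assumes "t \<in> {0<..<1}"
  shows "isCont \<gamma> t"
proof -
  have "\<gamma> piecewise_C1_differentiable_on {t/2..(t+1)/2}"
    using curve assms unfolding C1_curve_def by auto
  then have "continuous_on {t/2..(t+1)/2} \<gamma>"
    by (simp add: piecewise_C1_differentiable_on_def)
  then show ?thesis
    by (rule continuous_on_interior) (use assms in simp)
qed

lemma curve_has_vector_derivative:
  assumes "0 < a" "b < 1"
  obtains S where "finite S"
    "\<And>t. t \<in> {a<..<b} - S \<Longrightarrow> (\<gamma> has_vector_derivative vector_derivative \<gamma> (at t)) (at t)"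
proof (cases "a < b")
  case True
  then have "\<gamma> piecewise_C1_differentiable_on {a..b}"
    using curve assms unfolding C1_curve_def by auto
  then obtain S where "finite S" "\<gamma> C1_differentiable_on ({a..b} - S)"
    by (auto simp: piecewise_C1_differentiable_on_def)
  then show thesis
    using that by (auto simp: C1_differentiable_on_eq vector_derivative_works)
next
  case False
  then show thesis using that[of "{}"] by auto
qed

text \<open>Comparing neighbouring germs at the centre \<open>s = \<gamma> u\<close> replaces the
  moving germ by the fixed one at \<open>t\<close>. The weight is thus locally an analytic function
  composed with the curve.\<close>

lemma weight_eq_germ:
  assumes "t \<in> {0<..<1}"
  shows "\<forall>\<^sub>F u in nhds t. inverse (\<rho> u (\<gamma> u)) = inverse (\<rho> t (\<gamma> u))"
proof -
  have "\<forall>\<^sub>F u in at t. \<forall>\<^sub>F s in nhds (\<gamma> u). inverse (\<rho> u s) = inverse (\<rho> t s)"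
    using weight assms unfolding nonzero_solution_along_def analytic_continuation_along_def by blast
  then have "\<forall>\<^sub>F u in at t. inverse (\<rho> u (\<gamma> u)) = inverse (\<rho> t (\<gamma> u))"
    by (rule eventually_mono) (rule eventually_nhds_x_imp_x)
  then show ?thesis by (simp add: eventually_nhds_conv_at)
qed

lemma germ_holomorphic:
  assumes "t \<in> {0<..<1}"
  obtains e where "e > 0" "(\<lambda>s. inverse (\<rho> t s)) holomorphic_on ball (\<gamma> t) e"
  using weight assms
  unfolding nonzero_solution_along_def analytic_continuation_along_def analytic_on_def
  by (metis singletonI)

text \<open>The equation for \<open>\<rho>\<close> holds only on a punctured neighbourhood. There it
  becomes \<open>\<sigma> F' + \<kappa>0 F = 0\<close>, whose left side is continuous at the centre
  because \<open>F\<close> is analytic, so it vanishes there as well.\<close>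

lemma germ_deriv:
  assumes t: "t \<in> {0<..<1}"
  defines "F \<equiv> \<lambda>s. inverse (\<rho> t s)"
  shows "(F has_field_derivative deriv F (\<gamma> t)) (at (\<gamma> t))"
    and "poly \<sigma> (\<gamma> t) * deriv F (\<gamma> t) = - poly \<kappa>0 (\<gamma> t) * F (\<gamma> t)"
proof -
  obtain e where e: "e > 0" "F holomorphic_on ball (\<gamma> t) e"
    using germ_holomorphic[OF t] unfolding F_def by blast
  then show "(F has_field_derivative deriv F (\<gamma> t)) (at (\<gamma> t))"
    by (intro holomorphic_derivI[OF e(2)]) auto
  let ?g = "\<lambda>s. poly \<sigma> s * deriv F s + poly \<kappa>0 s * F s"
  have "?g holomorphic_on ball (\<gamma> t) e"
    using e by (intro holomorphic_intros holomorphic_deriv) auto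
  then have "isCont ?g (\<gamma> t)"
    using e(1) by (meson centre_in_ball continuous_on_interior holomorphic_on_imp_continuous_on
        interior_open open_ball continuous_on_eq_continuous_at)
  then have lim: "(?g \<longlongrightarrow> ?g (\<gamma> t)) (at (\<gamma> t))"
    by (simp add: isCont_def)
  have "\<forall>\<^sub>F s in at (\<gamma> t). \<rho> t s \<noteq> 0 \<and> \<rho> t field_differentiable (at s) \<and>
        poly \<sigma> s * deriv (\<rho> t) s - poly \<kappa>0 s * \<rho> t s = 0"
    using weight t unfolding nonzero_solution_along_def by blast
  then have "\<forall>\<^sub>F s in at (\<gamma> t). ?g s = 0"
  proof (rule eventually_mono)
    fix s assume s: "\<rho> t s \<noteq> 0 \<and> \<rho> t field_differentiable (at s) \<and>
        poly \<sigma> s * deriv (\<rho> t) s - poly \<kappa>0 s * \<rho> t s = 0"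
    then have "(\<rho> t has_field_derivative deriv (\<rho> t) s) (at s)"
      by (simp add: DERIV_deriv_iff_field_differentiable)
    then have "(F has_field_derivative - (inverse (\<rho> t s) * deriv (\<rho> t) s * inverse (\<rho> t s))) (at s)"
      unfolding F_def using s by (intro DERIV_inverse') auto
    then have "deriv F s = - (inverse (\<rho> t s) * deriv (\<rho> t) s * inverse (\<rho> t s))"
      by (rule DERIV_imp_deriv)
    then have "?g s = - (poly \<sigma> s * deriv (\<rho> t) s - poly \<kappa>0 s * \<rho> t s) * inverse (\<rho> t s) ^ 2"
      using s by (simp add: F_def field_simps power2_eq_square)
    then show "?g s = 0" using s by simp
  qed
  then have "(?g \<longlongrightarrow> 0) (at (\<gamma> t))"
    by (rule tendsto_eventually)
  then have "?g (\<gamma> t) = 0"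
    using lim tendsto_unique[of "at (\<gamma> t)"] by (metis trivial_limit_at)
  then show "poly \<sigma> (\<gamma> t) * deriv F (\<gamma> t) = - poly \<kappa>0 (\<gamma> t) * F (\<gamma> t)"
    by (simp add: add_eq_0_iff)
qed

lemma isCont_weight:
  assumes "t \<in> {0<..<1}"
  shows "isCont (\<lambda>u. inverse (\<rho> u (\<gamma> u))) t"
proof -
  have "isCont (\<lambda>u. inverse (\<rho> t (\<gamma> u))) t"
    using isCont_o2[OF isCont_curve[OF assms] DERIV_isCont[OF germ_deriv(1)[OF assms]]] .
  then show ?thesis
    using isCont_cong[OF weight_eq_germ[OF assms]] by blast
qed

lemma weight_has_vector_derivative:
  assumes t: "t \<in> {0<..<1}" and d: "(\<gamma> has_vector_derivative d) (at t)"
  shows "((\<lambda>u. inverse (\<rho> u (\<gamma> u))) has_vector_derivative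
            d * deriv (\<lambda>s. inverse (\<rho> t s)) (\<gamma> t)) (at t)"
proof -
  have "((\<lambda>u. inverse (\<rho> t (\<gamma> u))) has_vector_derivative
            d * deriv (\<lambda>s. inverse (\<rho> t s)) (\<gamma> t)) (at t)"
    using field_vector_diff_chain_at[OF d germ_deriv(1)[OF t]] by (simp add: o_def)
  then show ?thesis
    using weight_eq_germ[OF t] eventually_nhds_x_imp_x[OF weight_eq_germ[OF t]]
    by (subst has_vector_derivative_cong_ev) auto
qed

section \<open>The branch of the logarithm: local formula and derivatives\<close>

lemma exp_branch:
  assumes "t \<in> {0<..<1}" "z \<in> \<Omega>"
  shows "exp (L t z) = \<gamma> t - z"
  using branch assms by (auto simp: log_branch_along_def)

lemma curve_avoids:
  assumes "t \<in> {0<..<1}" "z \<in> \<Omega>"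
  shows "\<gamma> t - z \<noteq> 0"
  using exp_branch[OF assms] by (metis exp_not_eq_zero)

text \<open>By joint continuity \<open>L t z - L t0 z0\<close> has norm below pi near the base
  point, so its imaginary part lies in the strip where \<open>Ln\<close> inverts \<open>exp\<close>.
  The separate neighbourhoods \<open>P\<close> and \<open>Q\<close> allow either variable to be
  frozen. Differentiability of the branch, which is only assumed continuous, follows from this
  formula.\<close>

lemma branch_eq_Ln:
  assumes t0: "t0 \<in> {0<..<1}" and z0: "z0 \<in> \<Omega>"
  obtains P Q where "eventually P (nhds t0)" "eventually Q (nhds z0)"
    "\<And>t z. P t \<Longrightarrow> Q z \<Longrightarrow> t \<in> {0<..<1}"
    "\<And>t z. P t \<Longrightarrow> Q z \<Longrightarrow> L t z = L t0 z0 + Ln ((\<gamma> t - z) / (\<gamma> t0 - z0))"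
proof -
  have op: "open ({0<..<1::real} \<times> \<Omega>)"
    using open_\<Omega> by (intro open_Times) auto
  have "continuous_on ({0<..<1} \<times> \<Omega>) (\<lambda>p. L (fst p) (snd p))"
    using branch by (simp add: log_branch_along_def case_prod_unfold)
  then have "isCont (\<lambda>p. L (fst p) (snd p)) (t0, z0)"
    using op t0 z0 by (simp add: continuous_on_eq_continuous_at)
  then have "((\<lambda>p. L (fst p) (snd p)) \<longlongrightarrow> L t0 z0) (nhds (t0, z0))"
    using tendsto_at_iff_tendsto_nhds[of "\<lambda>p. L (fst p) (snd p)" "(t0, z0)"] by (simp add: isCont_def)
  then have "\<forall>\<^sub>F p in nhds (t0, z0). dist (L (fst p) (snd p)) (L t0 z0) < pi"
    by (rule tendstoD) simp
  moreover have "\<forall>\<^sub>F p in nhds (t0, z0). p \<in> {0<..<1} \<times> \<Omega>"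
    using op t0 z0 by (intro eventually_nhds_in_open) auto
  ultimately have "\<forall>\<^sub>F p in nhds t0 \<times>\<^sub>F nhds z0.
      dist (L (fst p) (snd p)) (L t0 z0) < pi \<and> p \<in> {0<..<1} \<times> \<Omega>"
    by (simp add: nhds_prod eventually_conj_iff)
  then obtain P Q where PQ: "eventually P (nhds t0)" "eventually Q (nhds z0)"
    and imp: "\<And>t z. P t \<Longrightarrow> Q z \<Longrightarrow> dist (L t z) (L t0 z0) < pi \<and> (t, z) \<in> {0<..<1} \<times> \<Omega>"
    unfolding eventually_prod_filter by auto
  have "L t z = L t0 z0 + Ln ((\<gamma> t - z) / (\<gamma> t0 - z0))" if "P t" "Q z" for t z
  proof -
    have tz: "t \<in> {0<..<1}" "z \<in> \<Omega>" using imp[OF that] by auto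
    have "\<bar>Im (L t z - L t0 z0)\<bar> < pi"
      using imp[OF that] abs_Im_le_cmod[of "L t z - L t0 z0"] by (simp add: dist_norm)
    then have "Ln (exp (L t z - L t0 z0)) = L t z - L t0 z0"
      by (intro Ln_exp) auto
    moreover have "exp (L t z - L t0 z0) = (\<gamma> t - z) / (\<gamma> t0 - z0)"
      using exp_branch[OF tz] exp_branch[OF t0 z0] by (simp add: exp_diff)
    ultimately show ?thesis by simp
  qed
  with PQ imp show thesis using that by blast
qed

lemma branch_has_field_derivative:
  assumes t: "t \<in> {0<..<1}" and z: "z \<in> \<Omega>"
  shows "(L t has_field_derivative - 1 / (\<gamma> t - z)) (at z)"
proof -
  obtain P Q where PQ: "eventually P (nhds t)" "eventually Q (nhds z)"
    and eq: "\<And>u w. P u \<Longrightarrow> Q w \<Longrightarrow> L u w = L t z + Ln ((\<gamma> u - w) / (\<gamma> t - z))"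
    using branch_eq_Ln[OF t z] by metis
  have "P t" using PQ(1) by (rule eventually_nhds_x_imp_x)
  then have ev: "\<forall>\<^sub>F w in nhds z. L t w = L t z + Ln ((\<gamma> t - w) / (\<gamma> t - z))"
    using PQ(2) eq by (auto elim: eventually_mono)
  have "((\<lambda>w. L t z + Ln ((\<gamma> t - w) / (\<gamma> t - z))) has_field_derivative - 1 / (\<gamma> t - z)) (at z)"
    using curve_avoids[OF t z] by (auto intro!: derivative_eq_intros simp: divide_simps)
  then show ?thesis
    using DERIV_cong_ev[OF refl ev refl] by blast
qed

lemma branch_has_vector_derivative:
  assumes t: "t \<in> {0<..<1}" and z: "z \<in> \<Omega>" and d: "(\<gamma> has_vector_derivative d) (at t)"
  shows "((\<lambda>u. L u z) has_vector_derivative d / (\<gamma> t - z)) (at t)"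
proof -
  obtain P Q where PQ: "eventually P (nhds t)" "eventually Q (nhds z)"
    and eq: "\<And>u w. P u \<Longrightarrow> Q w \<Longrightarrow> L u w = L t z + Ln ((\<gamma> u - w) / (\<gamma> t - z))"
    using branch_eq_Ln[OF t z] by metis
  have "Q z" using PQ(2) by (rule eventually_nhds_x_imp_x)
  then have ev: "\<forall>\<^sub>F u in nhds t. L u z = L t z + Ln ((\<gamma> u - z) / (\<gamma> t - z))"
    using PQ(1) eq by (auto elim: eventually_mono)
  have "((\<lambda>s. L t z + Ln ((s - z) / (\<gamma> t - z))) has_field_derivative 1 / (\<gamma> t - z)) (at (\<gamma> t))"
    using curve_avoids[OF t z] by (auto intro!: derivative_eq_intros)
  from field_vector_diff_chain_at[OF d this]
  have "((\<lambda>u. L t z + Ln ((\<gamma> u - z) / (\<gamma> t - z))) has_vector_derivative d / (\<gamma> t - z)) (at t)"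
    by (simp add: o_def)
  then show ?thesis
    using ev eventually_nhds_x_imp_x[OF ev] by (subst has_vector_derivative_cong_ev) auto
qed

lemma isCont_branch:
  assumes t: "t \<in> {0<..<1}" and z: "z \<in> \<Omega>"
  shows "isCont (\<lambda>u. L u z) t"
proof -
  have "continuous_on ({0<..<1} \<times> \<Omega>) (\<lambda>p. L (fst p) (snd p))"
    using branch by (simp add: log_branch_along_def case_prod_unfold)
  then have "continuous_on {0<..<1} (\<lambda>u. L (fst (u, z)) (snd (u, z)))"
    by (rule continuous_on_compose2[where f = "\<lambda>u. (u, z)"]) (use z in \<open>auto intro!: continuous_intros\<close>)
  then show ?thesis using t by (simp add: continuous_on_eq_continuous_at)
qed

lemma branch_power_Suc:
  assumes "t \<in> {0<..<1}" "z \<in> \<Omega>"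
  shows "branch_power L (a + 1) t z = (\<gamma> t - z) * branch_power L a t z"
  using exp_branch[OF assms] by (simp add: branch_power_def ring_distribs exp_add)

subsection \<open>Integrals over compact pieces of the curve\<close>

definition boundary :: "complex \<Rightarrow> real \<Rightarrow> complex \<Rightarrow> complex" where
  "boundary n t z = poly \<sigma> (\<gamma> t) * branch_power L (- n - 2) t z * inverse (\<rho> t (\<gamma> t))"

lemma branch_power_has_field_derivative:
  assumes t: "t \<in> {0<..<1}" and z: "z \<in> \<Omega>"
  shows "(branch_power L a t has_field_derivative - a * branch_power L (a - 1) t z) (at z)"
  using curve_avoids[OF t z] branch_power_Suc[OF t z, of "a - 1"]
  unfolding branch_power_def
  by (auto intro!: derivative_eq_intros branch_has_field_derivative[OF t z])

text \<open>The product rule, with the lowest power \<open>(s-z)^(-n-3)\<close> taken out, leaves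
  the polynomial of \<open>hypergeometric_poly_identity\<close>; its three terms give the three
  integrands.\<close>

lemma boundary_has_vector_derivative:
  assumes t: "t \<in> {0<..<1}" and z: "z \<in> \<Omega>"
    and d: "(\<gamma> has_vector_derivative vector_derivative \<gamma> (at t)) (at t)"
  shows "((\<lambda>u. boundary n u z) has_vector_derivative
     - ((n + 2) * poly \<sigma> z * integrand \<gamma> \<rho> L (n + 2) z t
        + ((n + 1) * poly (pderiv \<sigma>) z + poly \<kappa>0 z) * integrand \<gamma> \<rho> L (n + 1) z t
        + (poly (pderiv \<kappa>0) z + poly (pderiv (pderiv \<sigma>)) z / 2 * n) * integrand \<gamma> \<rho> L n z t))
     (at t)"
proof -
  define D where "D = vector_derivative \<gamma> (at t)"
  define s where "s = \<gamma> t"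
  define e where "e = branch_power L (- n - 3) t z"
  define W where "W = inverse (\<rho> t (\<gamma> t))"
  define W' where "W' = deriv (\<lambda>s. inverse (\<rho> t s)) (\<gamma> t)"
  have sz: "s - z \<noteq> 0" using curve_avoids[OF t z] by (simp add: s_def)
  have "- n - 3 + 1 = - n - 2" "- n - 2 + 1 = - n - 1" by simp_all
  then have e2: "branch_power L (- n - 2) t z = (s - z) * e"
    and "branch_power L (- n - 1) t z = (s - z) * branch_power L (- n - 2) t z"
    using branch_power_Suc[OF t z, of "- n - 3"] branch_power_Suc[OF t z, of "- n - 2"]
    unfolding e_def s_def by metis+
  then have e1: "branch_power L (- n - 1) t z = (s - z)\<^sup>2 * e"
    by (simp add: power2_eq_square)
  have 1: "((\<lambda>u. poly \<sigma> (\<gamma> u)) has_vector_derivative D * poly (pderiv \<sigma>) s) (at t)"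
    using field_vector_diff_chain_at[OF d poly_DERIV] by (simp add: o_def D_def s_def)
  have "((\<lambda>w. exp ((- n - 2) * w)) has_field_derivative exp ((- n - 2) * L t z) * (- n - 2)) (at (L t z))"
    by (auto intro!: derivative_eq_intros)
  from field_vector_diff_chain_at[OF branch_has_vector_derivative[OF t z d] this]
  have 2: "((\<lambda>u. branch_power L (- n - 2) u z) has_vector_derivative D * (e * (- n - 2))) (at t)"
    using e2 sz by (simp add: o_def branch_power_def D_def s_def)
  have 3: "((\<lambda>u. inverse (\<rho> u (\<gamma> u))) has_vector_derivative D * W') (at t)"
    using weight_has_vector_derivative[OF t d] by (simp add: D_def W'_def)
  \<comment> \<open>The derivative \<open>W'\<close> always occurs multiplied by \<sigma>, so there
    is no division by \<sigma> and the curve may pass through its zeros.\<close>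
  have \<sigma>W': "poly \<sigma> s * W' = - poly \<kappa>0 s * W"
    using germ_deriv(2)[OF t] by (simp add: s_def W'_def W_def)
  have "((\<lambda>u. boundary n u z) has_vector_derivative
      poly \<sigma> s * ((s - z) * e) * (D * W')
      + (poly \<sigma> s * (D * (e * (- n - 2))) + D * poly (pderiv \<sigma>) s * ((s - z) * e)) * W) (at t)"
    using has_vector_derivative_mult[OF has_vector_derivative_mult[OF 1 2] 3]
    by (simp add: boundary_def e2 W_def s_def)
  also have "poly \<sigma> s * ((s - z) * e) * (D * W')
      + (poly \<sigma> s * (D * (e * (- n - 2))) + D * poly (pderiv \<sigma>) s * ((s - z) * e)) * W
    = (s - z) * e * D * (poly \<sigma> s * W')
      + (poly \<sigma> s * (D * (e * (- n - 2))) + D * poly (pderiv \<sigma>) s * ((s - z) * e)) * W"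
    by (simp add: mult_ac)
  also have "\<dots> = e * W * D *
      (poly (pderiv \<sigma>) s * (s - z) - (n + 2) * poly \<sigma> s - poly \<kappa>0 s * (s - z))"
    unfolding \<sigma>W' by (simp add: algebra_simps)
  also note hypergeometric_poly_identity[OF deg_\<sigma> deg_\<kappa>0]
  also have "e * W * D *
     - ((n + 2) * poly \<sigma> z + ((n + 1) * poly (pderiv \<sigma>) z + poly \<kappa>0 z) * (s - z)
       + (poly (pderiv \<kappa>0) z + poly (pderiv (pderiv \<sigma>)) z / 2 * n) * (s - z)\<^sup>2)
   = - ((n + 2) * poly \<sigma> z * (e * W * D)
        + ((n + 1) * poly (pderiv \<sigma>) z + poly \<kappa>0 z) * ((s - z) * e * W * D)
        + (poly (pderiv \<kappa>0) z + poly (pderiv (pderiv \<sigma>)) z / 2 * n) * ((s - z)\<^sup>2 * e * W * D))"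
    by (simp add: algebra_simps)
  also have "e * W * D = integrand \<gamma> \<rho> L (n + 2) z t"
    by (simp add: integrand_def e_def W_def D_def diff_diff_eq add.commute)
  also have "(s - z) * e * W * D = integrand \<gamma> \<rho> L (n + 1) z t"
    by (simp add: integrand_def e2[symmetric] W_def D_def diff_diff_eq add.commute)
  also have "(s - z)\<^sup>2 * e * W * D = integrand \<gamma> \<rho> L n z t"
    by (simp add: integrand_def e1[symmetric] W_def D_def)
  finally show ?thesis .
qed

lemma isCont_boundary:
  assumes t: "t \<in> {0<..<1}" and z: "z \<in> \<Omega>"
  shows "isCont (\<lambda>u. boundary n u z) t"
  unfolding boundary_def branch_power_def
  by (intro continuous_mult isCont_weight[OF t] isCont_o2[OF isCont_curve[OF t] poly_isCont]
      isCont_o2[OF _ isCont_exp] continuous_const isCont_branch[OF t z])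

text \<open>The fundamental theorem of calculus with a finite exceptional set: at the break points
  of the curve, continuity of \<open>boundary\<close> is enough.\<close>

lemma boundary_has_integral:
  assumes ab: "0 < a" "a \<le> b" "b < 1" and z: "z \<in> \<Omega>"
  shows "((\<lambda>t. - ((n + 2) * poly \<sigma> z * integrand \<gamma> \<rho> L (n + 2) z t
        + ((n + 1) * poly (pderiv \<sigma>) z + poly \<kappa>0 z) * integrand \<gamma> \<rho> L (n + 1) z t
        + (poly (pderiv \<kappa>0) z + poly (pderiv (pderiv \<sigma>)) z / 2 * n) * integrand \<gamma> \<rho> L n z t))
     has_integral boundary n b z - boundary n a z) {a..b}"
proof -
  obtain S where "finite S"
    and S: "\<And>t. t \<in> {a<..<b} - S \<Longrightarrow> (\<gamma> has_vector_derivative vector_derivative \<gamma> (at t)) (at t)"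
    using curve_has_vector_derivative[OF ab(1,3)] by blast
  show ?thesis
  proof (rule fundamental_theorem_of_calculus_interior_strong[OF \<open>finite S\<close> ab(2)])
    show "continuous_on {a..b} (\<lambda>u. boundary n u z)"
      using ab z by (intro continuous_at_imp_continuous_on ballI isCont_boundary) auto
    fix t assume t: "t \<in> {a<..<b} - S"
    then have "t \<in> {0<..<1}" using ab by auto
    from boundary_has_vector_derivative[OF this z S[OF t]]
    show "((\<lambda>u. boundary n u z) has_vector_derivative
     - ((n + 2) * poly \<sigma> z * integrand \<gamma> \<rho> L (n + 2) z t
        + ((n + 1) * poly (pderiv \<sigma>) z + poly \<kappa>0 z) * integrand \<gamma> \<rho> L (n + 1) z t
        + (poly (pderiv \<kappa>0) z + poly (pderiv (pderiv \<sigma>)) z / 2 * n) * integrand \<gamma> \<rho> L n z t))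
     (at t)" .
  qed
qed

text \<open>The derivative of \<open>\<gamma>\<close> may be unbounded near a break point, so one cannot differentiate under the
  integral over a piece of the curve. Near a point the integrand has a primitive, and the integral
  may be taken along the chord instead.\<close>

lemma integrand_local_integral:
  assumes t0: "t0 \<in> {0<..<1}" and z0: "z0 \<in> \<Omega>"
  obtains d where "d > 0"
    "\<And>a b. a \<le> t0 \<Longrightarrow> t0 \<le> b \<Longrightarrow> b - a < d \<Longrightarrow>
       \<exists>J. \<forall>m. (\<forall>\<^sub>F z in nhds z0. (integrand \<gamma> \<rho> L m z has_integral J m z) {a..b}) \<and>
         (J m has_field_derivative (m + 1) * J (m + 1) z0) (at z0)"
proof -
  obtain P Q where PQ: "eventually P (nhds t0)" "eventually Q (nhds z0)"
    and P01: "\<And>t z. P t \<Longrightarrow> Q z \<Longrightarrow> t \<in> {0<..<1}"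
    and LLn: "\<And>t z. P t \<Longrightarrow> Q z \<Longrightarrow> L t z = L t0 z0 + Ln ((\<gamma> t - z) / (\<gamma> t0 - z0))"
    using branch_eq_Ln[OF t0 z0] by metis
  define F where "F = (\<lambda>s. inverse (\<rho> t0 s))"
  obtain e where e: "e > 0" "F holomorphic_on ball (\<gamma> t0) e"
    using germ_holomorphic[OF t0] unfolding F_def by blast
  define c where "c = \<gamma> t0 - z0"
  have c: "c \<noteq> 0" using curve_avoids[OF t0 z0] by (simp add: c_def)
  \<comment> \<open>If \<open>s\<close> and \<open>z\<close> move by less than \<delta>, then
    \<open>s - z\<close> differs from \<open>c\<close> by less than \<open>norm c\<close>. Hence
    \<open>(s - z) / c\<close> stays in the right half-plane, where \<open>Ln\<close> is
    holomorphic.\<close>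
  define \<delta> where "\<delta> = min e (norm c / 2)"
  have \<delta>: "\<delta> > 0" "\<delta> \<le> e" "2 * \<delta> \<le> norm c" using e c by (auto simp: \<delta>_def)
  let ?B = "ball (\<gamma> t0) \<delta>" and ?D = "ball z0 \<delta>"
  have F: "F holomorphic_on ?B"
    using e(2) \<delta>(2) by (meson holomorphic_on_subset subset_ball)
  have far: "(s - z) / c \<notin> \<real>\<^sub>\<le>\<^sub>0" "s - z \<noteq> 0" if "s \<in> ?B" "z \<in> ?D" for s z
  proof -
    have "norm ((s - z) - c) < norm c"
    proof -
      have "norm ((s - \<gamma> t0) - (z - z0)) \<le> norm (s - \<gamma> t0) + norm (z - z0)"
        by (rule norm_triangle_ineq4)
      also have "\<dots> < \<delta> + \<delta>"
        using that by (intro add_strict_mono) (auto simp: dist_norm norm_minus_commute)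
      finally show ?thesis using \<delta>(3) by (simp add: c_def algebra_simps)
    qed
    then have "norm (((s - z) - c) / c) < 1"
      using c by (simp add: norm_divide)
    moreover have "((s - z) - c) / c = (s - z) / c - 1"
      using c by (simp add: field_simps)
    ultimately have n: "norm ((s - z) / c - 1) < 1" by simp
    then have "\<bar>Re ((s - z) / c - 1)\<bar> < 1"
      using abs_Re_le_cmod le_less_trans by blast
    then have "Re ((s - z) / c) > 0" by simp
    then show "(s - z) / c \<notin> \<real>\<^sub>\<le>\<^sub>0" "s - z \<noteq> 0"
      by (auto simp: complex_nonpos_Reals_iff)
  qed
  \<comment> \<open>The integrand without the factor from the curve's derivative, now a function of
    independent points \<open>s\<close> and \<open>z\<close>, holomorphic in each.\<close>
  define H where "H = (\<lambda>m s z. exp ((- m - 1) * (L t0 z0 + Ln ((s - z) / c))) * F s)"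
  have H_suc: "(m + 1) * H (m + 1) s z = H m s z * (m + 1) / (s - z)" if "s \<in> ?B" "z \<in> ?D" for m s z
  proof -
    have "exp (L t0 z0 + Ln ((s - z) / c)) = s - z"
      using far[OF that] c exp_branch[OF t0 z0] by (simp add: exp_add c_def)
    moreover have "(- (m + 1) - 1) * X = (- m - 1) * X - X" for X :: complex
      by (simp add: algebra_simps)
    ultimately have "exp ((- (m + 1) - 1) * (L t0 z0 + Ln ((s - z) / c)))
        = exp ((- m - 1) * (L t0 z0 + Ln ((s - z) / c))) / (s - z)"
      by (simp only: exp_diff)
    then show ?thesis by (simp add: H_def)
  qed
  have H_deriv: "(H m s has_field_derivative (m + 1) * H (m + 1) s z) (at z)"
    if "s \<in> ?B" "z \<in> ?D" for m s z
    unfolding H_suc[OF that] using far[OF that] c unfolding H_def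
    by (auto intro!: derivative_eq_intros simp: divide_simps)
  have H_holo: "(\<lambda>s. H m s z) holomorphic_on ?B" if "z \<in> ?D" for m z
    unfolding H_def using far(1)[OF _ that] F c by (intro holomorphic_intros) auto
  have ev_t: "\<forall>\<^sub>F t in nhds t0. P t \<and> \<gamma> t \<in> ?B \<and> inverse (\<rho> t (\<gamma> t)) = F (\<gamma> t)"
  proof -
    have "(\<gamma> \<longlongrightarrow> \<gamma> t0) (nhds t0)"
      using isCont_curve[OF t0] tendsto_at_iff_tendsto_nhds[of \<gamma> t0] by (simp add: isCont_def)
    then have "\<forall>\<^sub>F t in nhds t0. \<gamma> t \<in> ?B"
      using \<delta>(1) by (intro topological_tendstoD) auto
    then show ?thesis
      using PQ(1) weight_eq_germ[OF t0] unfolding F_def by eventually_elim auto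
  qed
  then obtain d where d: "d > 0"
    and dt: "\<And>t. dist t t0 < d \<Longrightarrow> P t \<and> \<gamma> t \<in> ?B \<and> inverse (\<rho> t (\<gamma> t)) = F (\<gamma> t)"
    unfolding eventually_nhds_metric by blast
  have ev_z: "\<forall>\<^sub>F z in nhds z0. Q z \<and> z \<in> ?D"
    using PQ(2) \<delta>(1) by (intro eventually_conj eventually_nhds_in_open) auto
  have Qz0: "Q z0" using PQ(2) by (rule eventually_nhds_x_imp_x)
  show thesis
  proof (rule that[OF d])
    fix a b :: real assume ab: "a \<le> t0" "t0 \<le> b" "b - a < d"
    have near: "P t" "\<gamma> t \<in> ?B" "inverse (\<rho> t (\<gamma> t)) = F (\<gamma> t)" "t \<in> {0<..<1}"
      if "t \<in> {a..b}" for t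
    proof -
      have "dist t t0 < d" using that ab by (auto simp: dist_real_def)
      then show "P t" "\<gamma> t \<in> ?B" "inverse (\<rho> t (\<gamma> t)) = F (\<gamma> t)" "t \<in> {0<..<1}"
        using dt P01 Qz0 by blast+
    qed
    have aB: "\<gamma> a \<in> ?B" "\<gamma> b \<in> ?B" and a01: "0 < a" "b < 1"
      using near(2,4) ab by fastforce+
    have lp: "linepath (\<gamma> a) (\<gamma> b) u \<in> ?B" if "u \<in> {0..1}" for u
    proof -
      have "linepath (\<gamma> a) (\<gamma> b) u \<in> closed_segment (\<gamma> a) (\<gamma> b)"
        using that by (metis linepath_in_path)
      then show ?thesis
        using closed_segment_subset[OF aB convex_ball] by blast
    qed
    \<comment> \<open>The integral along the chord, which stays in the ball by convexity. Its
      parametrisation is affine, so the Leibniz rule applies.\<close>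
    define J where "J = (\<lambda>m z. integral (cbox 0 1)
        (\<lambda>u::real. H m (linepath (\<gamma> a) (\<gamma> b) u) z * (\<gamma> b - \<gamma> a)))"
    \<comment> \<open>Along the curve and along the chord, the integral is the same difference of
      end values of a primitive \<open>G\<close> of \<open>H m _ z\<close> on the ball.\<close>
    have int: "(integrand \<gamma> \<rho> L m z has_integral J m z) {a..b}" if z: "Q z" "z \<in> ?D" for m z
    proof -
      obtain G where G: "\<And>s. s \<in> ?B \<Longrightarrow> (G has_field_derivative H m s z) (at s within ?B)"
        using holomorphic_convex_primitive'[OF convex_ball open_ball H_holo[OF z(2)]] by blast
      then have G': "(G has_field_derivative H m s z) (at s)" if "s \<in> ?B" for s
        using that by (metis at_within_open open_ball)
      obtain S where S: "finite S"
        "\<And>t. t \<in> {a<..<b} - S \<Longrightarrow> (\<gamma> has_vector_derivative vector_derivative \<gamma> (at t)) (at t)"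
        using curve_has_vector_derivative[OF a01] by blast
      have "(integrand \<gamma> \<rho> L m z has_integral G (\<gamma> b) - G (\<gamma> a)) {a..b}"
      proof (rule fundamental_theorem_of_calculus_interior_strong[OF S(1)])
        show "a \<le> b" using ab by simp
        show "continuous_on {a..b} (\<lambda>t. G (\<gamma> t))"
          using near by (intro continuous_at_imp_continuous_on ballI
              isCont_o2[OF isCont_curve DERIV_isCont[OF G']]) auto
        fix t assume t: "t \<in> {a<..<b} - S"
        then have tab: "t \<in> {a..b}" by auto
        have "integrand \<gamma> \<rho> L m z t = vector_derivative \<gamma> (at t) * H m (\<gamma> t) z"
          unfolding integrand_def branch_power_def H_def near(3)[OF tab] LLn[OF near(1)[OF tab] z(1)]
          by (simp add: c_def)
        then show "((\<lambda>t. G (\<gamma> t)) has_vector_derivative integrand \<gamma> \<rho> L m z t) (at t)"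
          using field_vector_diff_chain_at[OF S(2)[OF t] G'[OF near(2)[OF tab]]] by (simp add: o_def)
      qed
      moreover have "((\<lambda>s. H m s z) has_contour_integral G (\<gamma> b) - G (\<gamma> a)) (linepath (\<gamma> a) (\<gamma> b))"
        using contour_integral_primitive[OF G, of "linepath (\<gamma> a) (\<gamma> b)"]
          closed_segment_subset[OF aB convex_ball] by simp
      then have "J m z = G (\<gamma> b) - G (\<gamma> a)"
        unfolding has_contour_integral_linepath J_def by (metis box_real(2) integral_unique)
      ultimately show ?thesis by simp
    qed
    have cont: "continuous_on (?D \<times> cbox 0 1)
        (\<lambda>p. H m (linepath (\<gamma> a) (\<gamma> b) (snd p)) (fst p) * (\<gamma> b - \<gamma> a))" for m
    proof -
      have lpc: "continuous_on (?D \<times> cbox 0 1)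
          (\<lambda>p::complex \<times> real. linepath (\<gamma> a) (\<gamma> b) (snd p))"
        unfolding linepath_def by (intro continuous_intros)
      have cF: "continuous_on (?D \<times> cbox 0 1) (\<lambda>p::complex \<times> real. F (linepath (\<gamma> a) (\<gamma> b) (snd p)))"
        using lp by (intro continuous_on_compose2[OF holomorphic_on_imp_continuous_on[OF F] lpc]) auto
      have cLn: "continuous_on (?D \<times> cbox 0 1)
          (\<lambda>p::complex \<times> real. Ln ((linepath (\<gamma> a) (\<gamma> b) (snd p) - fst p) / c))"
      proof (rule continuous_on_Ln')
        show "continuous_on (?D \<times> cbox 0 1)
          (\<lambda>p::complex \<times> real. (linepath (\<gamma> a) (\<gamma> b) (snd p) - fst p) / c)"
          using c by (intro continuous_intros lpc) auto
        show "(linepath (\<gamma> a) (\<gamma> b) (snd p) - fst p) / c \<notin> \<real>\<^sub>\<le>\<^sub>0"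
          if "p \<in> ?D \<times> cbox (0::real) 1" for p
          using that by (intro far(1) lp) auto
      qed
      show ?thesis
        unfolding H_def
        by (intro continuous_on_mult continuous_on_exp continuous_on_add continuous_on_const cF cLn)
    qed
    have "(J m has_field_derivative (m + 1) * J (m + 1) z0) (at z0)" for m
    proof -
      let ?f = "\<lambda>m z u. H m (linepath (\<gamma> a) (\<gamma> b) u) z * (\<gamma> b - \<gamma> a)"
      have "((\<lambda>z. integral (cbox 0 1) (?f m z)) has_field_derivative
          integral (cbox 0 1) (\<lambda>u. (m + 1) * ?f (m + 1) z0 u)) (at z0 within ?D)"
      proof (rule leibniz_rule_field_derivative[where fx = "\<lambda>z u. (m + 1) * ?f (m + 1) z u"])
        fix z u assume zu: "z \<in> ?D" "u \<in> cbox (0::real) 1"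
        show "((\<lambda>z. ?f m z u) has_field_derivative (m + 1) * ?f (m + 1) z u) (at z within ?D)"
          using DERIV_cmult_right[OF has_field_derivative_at_within[OF H_deriv[OF lp zu(1)]]] zu(2)
          by (simp add: mult.assoc)
      next
        fix z assume z: "z \<in> ?D"
        have "continuous_on (cbox 0 1) (\<lambda>u. ?f m (fst (z, u)) (snd (z, u)))"
          by (rule continuous_on_compose2[OF cont, of _ "\<lambda>u. (z, u)"])
             (use z in \<open>auto intro!: continuous_intros\<close>)
        then show "?f m z integrable_on cbox 0 1"
          by (intro integrable_continuous) simp
      next
        show "continuous_on (?D \<times> cbox 0 1) (\<lambda>(z, u). (m + 1) * ?f (m + 1) z u)"
          using continuous_on_mult_left[OF cont[of "m + 1"], of "m + 1"] by (simp add: case_prod_unfold)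
      qed (use \<delta> in auto)
      then show ?thesis
        using \<delta>(1) unfolding J_def integral_mult_right by (simp add: at_within_open[of z0 ?D])
    qed
    moreover have "\<forall>\<^sub>F z in nhds z0. (integrand \<gamma> \<rho> L m z has_integral J m z) {a..b}" for m
      using ev_z int by (auto elim: eventually_mono)
    ultimately show "\<exists>J. \<forall>m. (\<forall>\<^sub>F z in nhds z0. (integrand \<gamma> \<rho> L m z has_integral J m z) {a..b}) \<and>
         (J m has_field_derivative (m + 1) * J (m + 1) z0) (at z0)"
      by blast
  qed
qed

text \<open>The property holds on all sufficiently short intervals around a point and is preserved
  when adjacent intervals are joined, so bisection yields it on \<open>{a..b}\<close>. A single
  \<open>J\<close> serves all \<open>m\<close>, because the derivative of \<open>J m\<close> refers
  to \<open>J (m + 1)\<close>.\<close>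

lemma integrand_integral:
  assumes ab: "0 < a" "a \<le> b" "b < 1" and z0: "z0 \<in> \<Omega>"
  shows "\<exists>J. \<forall>m. (\<forall>\<^sub>F z in nhds z0. (integrand \<gamma> \<rho> L m z has_integral J m z) {a..b}) \<and>
         (J m has_field_derivative (m + 1) * J (m + 1) z0) (at z0)"
proof -
  define R where "R = (\<lambda>J a b. \<forall>m.
     (\<forall>\<^sub>F z in nhds z0. (integrand \<gamma> \<rho> L m z has_integral J m z) {a..b}) \<and>
         (J m has_field_derivative (m + 1) * J (m + 1) z0) (at z0))"
  have "\<exists>J. R J a b"
    using ab(2)
  proof (induction rule: Bolzano)
    case (trans x y w)
    then obtain J K where JK: "R J x y" "R K y w" by blast
    have J: "\<forall>\<^sub>F z in nhds z0. (integrand \<gamma> \<rho> L m z has_integral J m z) {x..y}"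
        "(J m has_field_derivative (m + 1) * J (m + 1) z0) (at z0)"
      and K: "\<forall>\<^sub>F z in nhds z0. (integrand \<gamma> \<rho> L m z has_integral K m z) {y..w}"
        "(K m has_field_derivative (m + 1) * K (m + 1) z0) (at z0)" for m
      using JK unfolding R_def by blast+
    have "\<forall>\<^sub>F z in nhds z0. (integrand \<gamma> \<rho> L m z has_integral J m z + K m z) {x..w}" for m
      using J(1)[of m] K(1)[of m] by eventually_elim (rule has_integral_combine[OF trans(3,4)])
    moreover have "((\<lambda>z. J m z + K m z) has_field_derivative (m + 1) * (J (m + 1) z0 + K (m + 1) z0)) (at z0)" for m
      using DERIV_add[OF J(2)[of m] K(2)[of m]] by (simp add: distrib_left)
    ultimately show ?case
      unfolding R_def by (intro exI[of _ "\<lambda>m z. J m z + K m z"]) auto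
  next
    case (local x)
    then have "x \<in> {0<..<1}" using ab by auto
    from integrand_local_integral[OF this z0] obtain d where "d > 0"
      "\<And>a b. a \<le> x \<Longrightarrow> x \<le> b \<Longrightarrow> b - a < d \<Longrightarrow>
       \<exists>J. \<forall>m. (\<forall>\<^sub>F z in nhds z0. (integrand \<gamma> \<rho> L m z has_integral J m z) {a..b}) \<and>
         (J m has_field_derivative (m + 1) * J (m + 1) z0) (at z0)"
      by blast
    then show ?case
      unfolding R_def by (intro exI[of _ d]) simp
  qed
  then show ?thesis by (simp add: R_def)
qed

lemma integrand_integrable:
  assumes "0 < a" "a \<le> b" "b < 1" and "z \<in> \<Omega>"
  shows "integrand \<gamma> \<rho> L m z integrable_on {a..b}"
  using integrand_integral[OF assms] eventually_nhds_x_imp_x by (meson has_integral_integrable)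

lemma truncated_integral_deriv:
  assumes "0 < a" "a \<le> b" "b < 1" and "z0 \<in> \<Omega>"
  shows "((\<lambda>z. integral {a..b} (integrand \<gamma> \<rho> L m z)) has_field_derivative
      (m + 1) * integral {a..b} (integrand \<gamma> \<rho> L (m + 1) z0)) (at z0)"
proof -
  obtain J where J: "\<And>m. \<forall>\<^sub>F z in nhds z0. (integrand \<gamma> \<rho> L m z has_integral J m z) {a..b}"
    and dJ: "\<And>m. (J m has_field_derivative (m + 1) * J (m + 1) z0) (at z0)"
    using integrand_integral[OF assms] by blast
  have ev: "\<forall>\<^sub>F z in nhds z0. integral {a..b} (integrand \<gamma> \<rho> L m z) = J m z" for m
    using J[of m] by eventually_elim (rule integral_unique)
  have "integral {a..b} (integrand \<gamma> \<rho> L (m + 1) z0) = J (m + 1) z0"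
    using ev[of "m + 1"] by (rule eventually_nhds_x_imp_x)
  then show ?thesis
    using dJ[of m] DERIV_cong_ev[OF refl ev[of m] refl] by simp
qed

subsection \<open>Passage to the limit\<close>

text \<open>The truncations form a sequence because Montel's theorem is about sequences. The offset
  3 makes the first one the interval from 1/3 to 2/3.\<close>

definition left_end :: "nat \<Rightarrow> real" where "left_end k = 1 / (real k + 3)"

definition right_end :: "nat \<Rightarrow> real" where "right_end k = 1 - 1 / (real k + 3)"

lemma ends: "0 < left_end k" "left_end k \<le> right_end k" "right_end k < 1"
  by (auto simp: left_end_def right_end_def field_simps)

lemma ends_mem: "left_end k \<in> {0<..<1}" "right_end k \<in> {0<..<1}"
  using ends[of k] by auto

lemma ends_neq: "left_end k \<noteq> 0" "right_end k \<noteq> 1"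
  using ends_mem[of k] by auto

lemma left_end_tendsto: "filterlim left_end (at_right 0) sequentially"
proof -
  have "left_end \<longlonglongrightarrow> 0"
    unfolding left_end_def by real_asymp
  then show ?thesis
    using ends_mem by (auto simp: filterlim_at ends_neq intro!: always_eventually)
qed

lemma right_end_tendsto: "filterlim right_end (at_left 1) sequentially"
proof -
  have "right_end \<longlonglongrightarrow> 1"
    unfolding right_end_def by real_asymp
  then show ?thesis
    using ends_mem by (auto simp: filterlim_at ends_neq intro!: always_eventually)
qed

definition trunc :: "complex \<Rightarrow> nat \<Rightarrow> complex \<Rightarrow> complex" where
  "trunc m k z = integral {left_end k..right_end k} (integrand \<gamma> \<rho> L m z)"

definition boundary_diff :: "complex \<Rightarrow> nat \<Rightarrow> complex \<Rightarrow> complex" where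
  "boundary_diff m k z = boundary m (right_end k) z - boundary m (left_end k) z"

lemma trunc_has_field_derivative:
  "z \<in> \<Omega> \<Longrightarrow> (trunc m k has_field_derivative (m + 1) * trunc (m + 1) k z) (at z)"
  using truncated_integral_deriv[OF ends] unfolding trunc_def by blast

lemma trunc_holomorphic: "trunc m k holomorphic_on \<Omega>"
  using trunc_has_field_derivative open_\<Omega> by (meson field_differentiable_def holomorphic_on_open)

lemma deriv_trunc: "z \<in> \<Omega> \<Longrightarrow> deriv (trunc m k) z = (m + 1) * trunc (m + 1) k z"
  using trunc_has_field_derivative by (rule DERIV_imp_deriv)

lemma deriv_deriv_trunc:
  assumes "z \<in> \<Omega>"
  shows "deriv (deriv (trunc m k)) z = (m + 1) * ((m + 2) * trunc (m + 2) k z)"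
proof -
  have "deriv (deriv (trunc m k)) z = deriv (\<lambda>z. (m + 1) * trunc (m + 1) k z) z"
    using assms open_\<Omega> deriv_trunc by (intro deriv_cong_ev refl) (auto simp: eventually_nhds)
  also have "\<dots> = (m + 1) * ((m + 1 + 1) * trunc (m + 1 + 1) k z)"
    by (intro DERIV_imp_deriv DERIV_cmult trunc_has_field_derivative assms)
  finally show ?thesis by (simp add: add.assoc)
qed

text \<open>The indefinite Henstock-Kurzweil integral is continuous up to both ends, so truncations
  converge also when the integral converges only conditionally.\<close>

lemma trunc_tendsto:
  assumes "f_well_defined \<gamma> \<rho> L m \<Omega>" "z \<in> \<Omega>"
  shows "(\<lambda>k. trunc m k z) \<longlonglongrightarrow> f_integral \<gamma> \<rho> L m z"
proof -
  let ?g = "integrand \<gamma> \<rho> L m z"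
  let ?I = "\<lambda>x. integral {0..x} ?g"
  have int: "?g integrable_on {0..1}"
    using assms by (simp add: f_well_defined_def)
  have cont: "continuous_on {0..1} ?I"
    by (rule indefinite_integral_continuous_1[OF int])
  have mem: "left_end k \<in> {0..1}" "right_end k \<in> {0..1}" for k
    using ends_mem[of k] by auto
  have "(\<lambda>k. ?I (right_end k)) \<longlonglongrightarrow> ?I 1"
    using filterlim_at[THEN iffD1, OF right_end_tendsto] mem
    by (intro continuous_on_tendsto_compose[OF cont]) auto
  moreover have "(\<lambda>k. ?I (left_end k)) \<longlonglongrightarrow> ?I 0"
    using filterlim_at[THEN iffD1, OF left_end_tendsto] mem
    by (intro continuous_on_tendsto_compose[OF cont]) auto
  ultimately have "(\<lambda>k. ?I (right_end k) - ?I (left_end k)) \<longlonglongrightarrow> ?I 1 - ?I 0"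
    by (rule tendsto_diff)
  moreover have "?I (right_end k) - ?I (left_end k) = trunc m k z" for k
  proof -
    have "?g integrable_on {0..right_end k}"
      using ends[of k] by (intro integrable_on_subinterval[OF int]) auto
    then have "?I (left_end k) + integral {left_end k..right_end k} ?g = ?I (right_end k)"
      using ends[of k] by (intro Henstock_Kurzweil_Integration.integral_combine) auto
    then show ?thesis by (simp add: trunc_def algebra_simps)
  qed
  ultimately show ?thesis by (simp add: f_integral_def)
qed

lemma trunc_recurrence:
  assumes z: "z \<in> \<Omega>"
  shows "poly \<sigma> z * ((n + 2) * trunc (n + 2) k z) + poly (kappa \<sigma> \<kappa>0 (n + 1)) z * trunc (n + 1) k z
      + (poly (pderiv \<kappa>0) z + poly (pderiv (pderiv \<sigma>)) z / 2 * n) * trunc n k z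
    = - boundary_diff n k z"
proof -
  let ?c2 = "(n + 2) * poly \<sigma> z" and ?c1 = "(n + 1) * poly (pderiv \<sigma>) z + poly \<kappa>0 z"
    and ?c0 = "poly (pderiv \<kappa>0) z + poly (pderiv (pderiv \<sigma>)) z / 2 * n"
  have "(integrand \<gamma> \<rho> L m z has_integral trunc m k z) {left_end k..right_end k}" for m
    unfolding trunc_def using integrand_integrable[OF ends z] by (rule integrable_integral)
  then have "((\<lambda>t. - (?c2 * integrand \<gamma> \<rho> L (n + 2) z t + ?c1 * integrand \<gamma> \<rho> L (n + 1) z t
        + ?c0 * integrand \<gamma> \<rho> L n z t)) has_integral
      - (?c2 * trunc (n + 2) k z + ?c1 * trunc (n + 1) k z + ?c0 * trunc n k z))
      {left_end k..right_end k}"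
    by (intro has_integral_neg has_integral_add has_integral_mult_right)
  from has_integral_unique[OF this boundary_has_integral[OF ends z]]
  show ?thesis
    by (simp add: boundary_diff_def kappa_def algebra_simps)
qed

text \<open>Multiplying the recurrence by \<open>n + 1\<close> turns
  \<open>(n + 1) (n + 2) trunc (n + 2)\<close> into the second derivative and
  \<open>(n + 1) trunc (n + 1)\<close> into the first.\<close>

lemma trunc_ode:
  assumes z: "z \<in> \<Omega>"
  shows "poly \<sigma> z * deriv (deriv (trunc n k)) z + poly (kappa \<sigma> \<kappa>0 (n + 1)) z * deriv (trunc n k) z
      + (n + 1) * (poly (pderiv \<kappa>0) z + poly (pderiv (pderiv \<sigma>)) z / 2 * n) * trunc n k z
    = - (n + 1) * boundary_diff n k z"
proof -
  have "- (n + 1) * boundary_diff n k z = (n + 1) * - boundary_diff n k z"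
    by (simp only: mult_minus_left mult_minus_right)
  then show ?thesis
    unfolding deriv_trunc[OF z] deriv_deriv_trunc[OF z] trunc_recurrence[OF z, symmetric]
    by (simp add: algebra_simps)
qed

text \<open>Near \<open>z0\<close> the branch of the logarithm changes by at most 1, uniformly along
  the curve, so the power changes by a bounded factor. The second claim is for
  \<open>f (n + 1)\<close>: its equation has the boundary term with index \<open>n + 1\<close>,
  about which the boundary condition says nothing directly.\<close>

lemma boundary_locally_bounded:
  assumes T: "\<And>k. T k \<in> {0<..<1}"
    and lim: "\<forall>z\<in>\<Omega>. convergent (\<lambda>k. boundary n (T k) z)"
  shows "locally_bounded_on \<Omega> (\<lambda>k. boundary n (T k))"
    and "locally_bounded_on \<Omega> (\<lambda>k. boundary (n + 1) (T k))"
proof -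
  have *: "\<exists>r>0. \<exists>B. \<forall>k. \<forall>w\<in>ball z0 r. norm (boundary n (T k) w) \<le> B \<and>
       norm (boundary (n + 1) (T k) w) \<le> B / r" if z0: "z0 \<in> \<Omega>" for z0
  proof -
    obtain R where R: "R > 0" "ball z0 R \<subseteq> \<Omega>"
      using open_\<Omega> z0 open_contains_ball by blast
    define r where "r = R / 2"
    have r: "r > 0" "ball z0 r \<subseteq> \<Omega>" using R by (auto simp: r_def)
    \<comment> \<open>With half the radius, a curve point closer than \<open>r\<close> to
      \<open>w\<close> would lie in \<open>ball z0 R\<close> and thus in \<Omega>, which the curve
      avoids.\<close>
    have far: "r \<le> norm (\<gamma> (T k) - w)" if w: "w \<in> ball z0 r" for k w
    proof (rule ccontr)
      assume "\<not> ?thesis"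
      then have "dist (\<gamma> (T k)) z0 < r + r"
        using w dist_triangle_less_add[of "\<gamma> (T k)" w r z0 r] by (auto simp: dist_norm norm_minus_commute)
      then have "\<gamma> (T k) \<in> \<Omega>" using R by (auto simp: r_def dist_commute)
      then show False using curve_avoids[OF T] by force
    qed
    obtain C where C: "\<And>k. norm (boundary n (T k) z0) \<le> C"
      using convergent_imp_Bseq[OF bspec[OF lim z0]] by (auto simp: Bseq_def)
    have C0: "0 \<le> C" using order_trans[OF norm_ge_zero C] .
    define B where "B = C * exp (norm (- n - 2))"
    have bd: "norm (boundary n (T k) w) \<le> B" if w: "w \<in> ball z0 r" for k w
    proof -
      let ?t = "T k"
      have "norm (L ?t w - L ?t z0) \<le> (1 / r) * norm (w - z0)"
      proof (rule field_differentiable_bound[OF convex_ball, where f' = "\<lambda>w. - 1 / (\<gamma> ?t - w)"])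
        fix y assume y: "y \<in> ball z0 r"
        show "(L ?t has_field_derivative - 1 / (\<gamma> ?t - y)) (at y within ball z0 r)"
          using has_field_derivative_at_within[OF branch_has_field_derivative[OF T subsetD[OF r(2) y]]] .
        show "norm (- 1 / (\<gamma> ?t - y)) \<le> 1 / r"
          using far[OF y, of k] r(1) by (simp add: norm_divide frac_le)
      qed (use w r(1) in simp_all)
      also have "\<dots> \<le> 1"
        using w r(1) by (simp add: dist_norm norm_minus_commute)
      finally have "norm ((- n - 2) * (L ?t w - L ?t z0)) \<le> norm (- n - 2)"
        by (simp add: norm_mult mult_left_le)
      then have "norm (exp ((- n - 2) * (L ?t w - L ?t z0))) \<le> exp (norm (- n - 2))"
        using norm_exp[of "(- n - 2) * (L ?t w - L ?t z0)"] by (meson exp_le_cancel_iff order_trans)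
      moreover have "boundary n ?t w = boundary n ?t z0 * exp ((- n - 2) * (L ?t w - L ?t z0))"
      proof -
        have "(- n - 2) * L ?t w = (- n - 2) * L ?t z0 + (- n - 2) * (L ?t w - L ?t z0)"
          by (simp add: algebra_simps)
        then have "exp ((- n - 2) * L ?t w)
            = exp ((- n - 2) * L ?t z0) * exp ((- n - 2) * (L ?t w - L ?t z0))"
          by (metis exp_add)
        then show ?thesis by (simp add: boundary_def branch_power_def)
      qed
      ultimately show ?thesis
        using C[of k] C0 unfolding B_def by (simp add: norm_mult mult_mono)
    qed
    \<comment> \<open>Raising the index by one divides the boundary term by
      \<open>\<gamma> (T k) - w\<close>, at the cost of a factor \<open>1 / r\<close>.\<close>
    have "norm (boundary (n + 1) (T k) w) \<le> B / r" if w: "w \<in> ball z0 r" for k w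
    proof -
      have "- (n + 1) - 2 + 1 = - n - 2" by simp
      then have "branch_power L (- n - 2) (T k) w = (\<gamma> (T k) - w) * branch_power L (- (n + 1) - 2) (T k) w"
        using branch_power_Suc[OF T subsetD[OF r(2) w], of "- (n + 1) - 2" k] by metis
      then have "boundary n (T k) w = (\<gamma> (T k) - w) * boundary (n + 1) (T k) w"
        unfolding boundary_def by (simp add: mult_ac)
      then have "norm (boundary (n + 1) (T k) w) * norm (\<gamma> (T k) - w) \<le> B"
        using bd[OF w, of k] by (simp add: norm_mult mult.commute)
      then have "norm (boundary (n + 1) (T k) w) * r \<le> B"
        using far[OF w, of k] by (meson mult_left_mono norm_ge_zero order_trans)
      then show ?thesis using r(1) by (simp add: field_simps)
    qed
    with bd r(1) show ?thesis by blast
  qed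
  show "locally_bounded_on \<Omega> (\<lambda>k. boundary n (T k))"
    and "locally_bounded_on \<Omega> (\<lambda>k. boundary (n + 1) (T k))"
    unfolding locally_bounded_on_def using * by meson+
qed

lemma boundary_diff_lims:
  assumes bd: "\<forall>z\<in>\<Omega>. has_boundary_difference (\<lambda>t. boundary n t z) 0"
  shows "z \<in> \<Omega> \<Longrightarrow> (\<lambda>k. boundary_diff n k z) \<longlonglongrightarrow> 0"
    and "locally_bounded_on \<Omega> (boundary_diff n)"
    and "locally_bounded_on \<Omega> (boundary_diff (n + 1))"
proof -
  have lim: "\<exists>g0 g1. (\<lambda>k. boundary n (left_end k) z) \<longlonglongrightarrow> g0 \<and>
      (\<lambda>k. boundary n (right_end k) z) \<longlonglongrightarrow> g1 \<and> g1 - g0 = 0" if z: "z \<in> \<Omega>" for z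
    using bspec[OF bd z] left_end_tendsto right_end_tendsto filterlim_compose
    unfolding has_boundary_difference_def by blast
  show "(\<lambda>k. boundary_diff n k z) \<longlonglongrightarrow> 0" if z: "z \<in> \<Omega>"
  proof -
    obtain g0 g1 where "(\<lambda>k. boundary n (left_end k) z) \<longlonglongrightarrow> g0"
      "(\<lambda>k. boundary n (right_end k) z) \<longlonglongrightarrow> g1" "g1 - g0 = 0"
      using lim[OF z] by blast
    then show ?thesis
      using tendsto_diff[of "\<lambda>k. boundary n (right_end k) z" g1 _ "\<lambda>k. boundary n (left_end k) z" g0]
      by (simp add: boundary_diff_def)
  qed
  have "\<forall>z\<in>\<Omega>. convergent (\<lambda>k. boundary n (left_end k) z)"
    "\<forall>z\<in>\<Omega>. convergent (\<lambda>k. boundary n (right_end k) z)"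
    using lim unfolding convergent_def by blast+
  note b = boundary_locally_bounded[of left_end n, OF ends_mem(1) this(1)]
    boundary_locally_bounded[of right_end n, OF ends_mem(2) this(2)]
  show "locally_bounded_on \<Omega> (boundary_diff n)"
    using locally_bounded_on_diff[OF b(3,1)] by (simp add: boundary_diff_def[abs_def])
  show "locally_bounded_on \<Omega> (boundary_diff (n + 1))"
    using locally_bounded_on_diff[OF b(4,2)] by (simp add: boundary_diff_def[abs_def])
qed

text \<open>The hypothesis asks for bounded boundary terms rather than vanishing ones, so that the
  lemma covers both \<open>n\<close> and \<open>n + 1\<close>.\<close>

lemma trunc_locally_bounded:
  assumes wd: "f_well_defined \<gamma> \<rho> L m \<Omega>" and bd: "locally_bounded_on \<Omega> (boundary_diff m)"
  shows "locally_bounded_on \<Omega> (trunc m)"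
  by (rule second_order_locally_bounded[OF open_\<Omega> trunc_holomorphic nz_\<sigma> _ _ trunc_ode
        locally_bounded_on_cmult[OF bd] trunc_tendsto[OF wd]])
     (intro continuous_intros; simp)+

text \<open>\<open>trunc_ode\<close> is passed to the limit along the subsequence on which all
  derivatives converge, and its right side tends to 0. If \<open>f (n + 1)\<close> exists, the first
  derivatives of the truncations have two expressions for their limit, which must agree.\<close>

lemma f_integral_ode:
  assumes wd: "f_well_defined \<gamma> \<rho> L n \<Omega>"
    and bd: "\<forall>z\<in>\<Omega>. has_boundary_difference (\<lambda>t. boundary n t z) 0"
  defines "f \<equiv> f_integral \<gamma> \<rho> L"
  shows "f n holomorphic_on \<Omega>"
    and "z \<in> \<Omega> \<Longrightarrow> poly \<sigma> z * deriv (deriv (f n)) z + poly (kappa \<sigma> \<kappa>0 (n + 1)) z * deriv (f n) z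
      + (n + 1) * (poly (pderiv \<kappa>0) z + poly (pderiv (pderiv \<sigma>)) z / 2 * n) * f n z = 0"
    and "f_well_defined \<gamma> \<rho> L (n + 1) \<Omega> \<Longrightarrow> z \<in> \<Omega> \<Longrightarrow> deriv (f n) z = (n + 1) * f (n + 1) z"
proof -
  note lim = trunc_tendsto[OF wd, folded f_def]
  obtain r :: "nat \<Rightarrow> nat" where holo: "f n holomorphic_on \<Omega>" and r: "strict_mono r"
    and dl: "\<And>j z. z \<in> \<Omega> \<Longrightarrow> (\<lambda>k. (deriv ^^ j) (trunc n (r k)) z) \<longlonglongrightarrow> (deriv ^^ j) (f n) z"
    using locally_bounded_convergent[OF open_\<Omega> trunc_holomorphic
        trunc_locally_bounded[OF wd boundary_diff_lims(2)[OF bd]] lim] by blast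
  show "f n holomorphic_on \<Omega>" by (rule holo)
  show "poly \<sigma> z * deriv (deriv (f n)) z + poly (kappa \<sigma> \<kappa>0 (n + 1)) z * deriv (f n) z
      + (n + 1) * (poly (pderiv \<kappa>0) z + poly (pderiv (pderiv \<sigma>)) z / 2 * n) * f n z = 0"
    if z: "z \<in> \<Omega>"
  proof (rule LIMSEQ_unique)
    show "(\<lambda>k. - (n + 1) * boundary_diff n (r k) z) \<longlonglongrightarrow>
      poly \<sigma> z * deriv (deriv (f n)) z + poly (kappa \<sigma> \<kappa>0 (n + 1)) z * deriv (f n) z
      + (n + 1) * (poly (pderiv \<kappa>0) z + poly (pderiv (pderiv \<sigma>)) z / 2 * n) * f n z"
      unfolding trunc_ode[OF z, symmetric]
      using dl[OF z, of 0] dl[OF z, of 1] dl[OF z, of 2]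
      by (intro tendsto_intros) (simp_all add: eval_nat_numeral)
    show "(\<lambda>k. - (n + 1) * boundary_diff n (r k) z) \<longlonglongrightarrow> 0"
      using LIMSEQ_subseq_LIMSEQ[OF boundary_diff_lims(1)[OF bd z] r]
      by (intro tendsto_mult_right_zero) (simp add: o_def)
  qed
  show "deriv (f n) z = (n + 1) * f (n + 1) z"
    if wd': "f_well_defined \<gamma> \<rho> L (n + 1) \<Omega>" and z: "z \<in> \<Omega>"
  proof (rule LIMSEQ_unique)
    show "(\<lambda>k. deriv (trunc n (r k)) z) \<longlonglongrightarrow> deriv (f n) z"
      using dl[OF z, of 1] by simp
    show "(\<lambda>k. deriv (trunc n (r k)) z) \<longlonglongrightarrow> (n + 1) * f (n + 1) z"
      unfolding deriv_trunc[OF z] f_def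
      using LIMSEQ_subseq_LIMSEQ[OF trunc_tendsto[OF wd' z] r]
      by (intro tendsto_intros) (simp add: o_def)
  qed
qed

text \<open>In \<open>trunc_recurrence\<close> the term \<open>(n + 2) trunc (n + 2)\<close> is read
  as the derivative of \<open>trunc (n + 1)\<close>. Its limit comes from Montel's theorem for index
  \<open>n + 1\<close>, so no integral with index \<open>n + 2\<close> has to converge.\<close>

lemma f_integral_recurrence:
  assumes wd: "f_well_defined \<gamma> \<rho> L n \<Omega>" and wd': "f_well_defined \<gamma> \<rho> L (n + 1) \<Omega>"
    and bd: "\<forall>z\<in>\<Omega>. has_boundary_difference (\<lambda>t. boundary n t z) 0"
  defines "f \<equiv> f_integral \<gamma> \<rho> L"
  shows "f (n + 1) holomorphic_on \<Omega>"
    and "z \<in> \<Omega> \<Longrightarrow> poly \<sigma> z * deriv (f (n + 1)) z + poly (kappa \<sigma> \<kappa>0 (n + 1)) z * f (n + 1) z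
      = - (poly (pderiv \<kappa>0) z + poly (pderiv (pderiv \<sigma>)) z / 2 * n) * f n z"
proof -
  note lim = trunc_tendsto[OF wd', folded f_def]
  obtain r :: "nat \<Rightarrow> nat" where holo: "f (n + 1) holomorphic_on \<Omega>" and r: "strict_mono r"
    and dl: "\<And>j z. z \<in> \<Omega> \<Longrightarrow>
      (\<lambda>k. (deriv ^^ j) (trunc (n + 1) (r k)) z) \<longlonglongrightarrow> (deriv ^^ j) (f (n + 1)) z"
    using locally_bounded_convergent[OF open_\<Omega> trunc_holomorphic
        trunc_locally_bounded[OF wd' boundary_diff_lims(3)[OF bd]] lim] by blast
  show "f (n + 1) holomorphic_on \<Omega>" by (rule holo)
  show "poly \<sigma> z * deriv (f (n + 1)) z + poly (kappa \<sigma> \<kappa>0 (n + 1)) z * f (n + 1) z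
      = - (poly (pderiv \<kappa>0) z + poly (pderiv (pderiv \<sigma>)) z / 2 * n) * f n z" if z: "z \<in> \<Omega>"
  proof (rule LIMSEQ_unique)
    let ?c = "poly (pderiv \<kappa>0) z + poly (pderiv (pderiv \<sigma>)) z / 2 * n"
    let ?u = "\<lambda>k. poly \<sigma> z * deriv (trunc (n + 1) (r k)) z
        + poly (kappa \<sigma> \<kappa>0 (n + 1)) z * trunc (n + 1) (r k) z"
    show "?u \<longlonglongrightarrow> poly \<sigma> z * deriv (f (n + 1)) z + poly (kappa \<sigma> \<kappa>0 (n + 1)) z * f (n + 1) z"
      using dl[OF z, of 0] dl[OF z, of 1] by (intro tendsto_intros) simp_all
    have "?u k = - boundary_diff n (r k) z - ?c * trunc n (r k) z" for k
      unfolding deriv_trunc[OF z] using trunc_recurrence[OF z, of n "r k"]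
      by (simp add: algebra_simps)
    moreover have "(\<lambda>k. - boundary_diff n (r k) z - ?c * trunc n (r k) z) \<longlonglongrightarrow> - 0 - ?c * f n z"
      using LIMSEQ_subseq_LIMSEQ[OF boundary_diff_lims(1)[OF bd z] r]
        LIMSEQ_subseq_LIMSEQ[OF trunc_tendsto[OF wd z] r] unfolding f_def
      by (intro tendsto_intros) (simp_all add: o_def)
    moreover have "- 0 - ?c * f n z = - ?c * f n z"
      by (simp only: minus_zero diff_0 mult_minus_left)
    ultimately show "?u \<longlonglongrightarrow> - ?c * f n z" by (simp only:)
  qed
qed

end

section \<open>The operator in expanded form and the final theorem\<close>

text \<open>In the zeroth-order term, \<open>(n \<sigma>'' + \<kappa>0') / 2\<close> from
  \<open>hyp_op\<close> and \<open>n^2 \<sigma>'' / 2 + (n + 1/2) \<kappa>0'\<close> from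
  \<open>omega\<close> add up to
  \<open>(n + 1) \<kappa>0' + n (n + 1) \<sigma>'' / 2\<close>.\<close>

lemma hyp_op_kappa_omega:
  "hyp_op \<sigma> (kappa \<sigma> \<kappa>0 n) g z + poly (omega \<sigma> \<kappa>0 n) z * g z =
     poly \<sigma> z * deriv (deriv g) z
     + (poly \<kappa>0 z + (n + 1) * poly (pderiv \<sigma>) z) * deriv g z
     + (poly (pderiv \<kappa>0) z * (n + 1) + poly (pderiv (pderiv \<sigma>)) z / 2 * n * (n + 1)) * g z"
  by (simp add: hyp_op_def kappa_def omega_def pderiv_add pderiv_smult field_simps power2_eq_square)

text \<open>Since \<open>deriv\<close> is total, the conclusion includes holomorphy on the open set
  \<Omega>, which makes the iterated \<open>deriv\<close> genuine derivatives. The first conjunct is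
  the equality of the two forms of the operator.\<close>

theorem theorem5p1:
  fixes \<sigma> \<kappa>0 :: "complex poly" and n :: complex
    and \<gamma> :: "real \<Rightarrow> complex" and \<rho> L :: "real \<Rightarrow> complex \<Rightarrow> complex"
    and \<Omega> :: "complex set"
  defines "f \<equiv> f_integral \<gamma> \<rho> L"
  assumes "degree \<sigma> \<le> 2" and "\<sigma> \<noteq> 0" and "degree \<kappa>0 \<le> 1"
    and "C1_curve \<gamma>"
    and "nonzero_solution_along \<sigma> \<kappa>0 \<gamma> \<rho>"
    and "open \<Omega>"
    and "log_branch_along \<gamma> \<Omega> L"
    and "\<And>z. z \<in> \<Omega> \<Longrightarrow>
           has_boundary_difference
             (\<lambda>t. poly \<sigma> (\<gamma> t) * branch_power L (- n - 2) t z * inverse (\<rho> t (\<gamma> t))) 0"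
    and "f_well_defined \<gamma> \<rho> L n \<Omega>"
  shows "(\<forall>g z. hyp_op \<sigma> (kappa \<sigma> \<kappa>0 n) g z + poly (omega \<sigma> \<kappa>0 n) z * g z =
            poly \<sigma> z * deriv (deriv g) z
            + (poly \<kappa>0 z + (n + 1) * poly (pderiv \<sigma>) z) * deriv g z
            + (poly (pderiv \<kappa>0) z * (n + 1)
               + poly (pderiv (pderiv \<sigma>)) z / 2 * n * (n + 1)) * g z)
    \<and> f n holomorphic_on \<Omega>
    \<and> (\<forall>z\<in>\<Omega>. hyp_op \<sigma> (kappa \<sigma> \<kappa>0 n) (f n) z + poly (omega \<sigma> \<kappa>0 n) z * f n z = 0)
    \<and> (f_well_defined \<gamma> \<rho> L (n + 1) \<Omega> \<longrightarrow>
         f (n + 1) holomorphic_on \<Omega>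
         \<and> (\<forall>z\<in>\<Omega>. deriv (f n) z = (n + 1) * f (n + 1) z)
         \<and> (\<forall>z\<in>\<Omega>. poly \<sigma> z * deriv (f (n + 1)) z + poly (kappa \<sigma> \<kappa>0 (n + 1)) z * f (n + 1) z =
              - (poly (pderiv \<kappa>0) z + poly (pderiv (pderiv \<sigma>)) z / 2 * n) * f n z))"
proof -
  interpret hypergeometric_curve \<sigma> \<kappa>0 \<gamma> \<rho> L \<Omega>
    using assms(2-8) by unfold_locales
  have bd: "\<forall>z\<in>\<Omega>. has_boundary_difference (\<lambda>t. boundary n t z) 0"
    using assms(9) by (simp add: boundary_def)
  note ode = f_integral_ode[OF assms(10) bd, folded f_def]
  \<comment> \<open>The first-order coefficient
    \<open>\<sigma>' + kappa \<sigma> \<kappa>0 n\<close> of \<open>hyp_op\<close> equals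
    \<open>kappa \<sigma> \<kappa>0 (n + 1)\<close>, the one in
    \<open>f_integral_ode\<close>.\<close>
  have "hyp_op \<sigma> (kappa \<sigma> \<kappa>0 n) (f n) z + poly (omega \<sigma> \<kappa>0 n) z * f n z = 0" if "z \<in> \<Omega>" for z
    using ode(2)[OF that] unfolding hyp_op_kappa_omega by (simp add: kappa_def algebra_simps)
  with ode(1,3) f_integral_recurrence[OF assms(10) _ bd, folded f_def]
  show ?thesis using hyp_op_kappa_omega by blast
qed

end
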